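(* Let $\mathcal{U}$ be a strategic $(p^+)$-filter on $E$. Then every analytic set $\mathbb{A}\subseteq 2^\omega\times E^{[\infty]}$ is perfectly $\mathcal{U}$-strategically Ramsey.
   Context: $F$ is a countable field and $E$ a countably infinite-dimensional $F$-vector space with fixed basis $(e_n)$; $\mathrm{supp}(v)$ is the set of indices of nonzero coefficients of $v\ne0$. Block sequences: sequences of nonzero vectors with $\max\mathrm{supp}(x_n)<\min\mathrm{supp}(x_{n+1})$; $E^{[\infty]}$ (Polish, subspace of $E^\omega$) and $E^{[<\infty]}$ are the infinite and finite ones. $Y\preceq X$ iff $\langle Y\rangle\subseteq\langle X\rangle$; $Y\preceq^*X$ iff some tail of $Y$ is $\preceq X$. Family: nonempty subset of $E^{[\infty]}$ upward closed under $\preceq^*$; filter: family whose any two members have a common $\preceq$-lower bound in it; $\mathcal{H}\restriction X=\{Y\in\mathcal{H}:Y\preceq X\}$. Full: whenever $D\subseteq E$ and $X\in\mathcal{H}$ are such that every $Y\in\mathcal{H}\restriction X$ has some $Z\preceq Y$ with $\langle Z\rangle\subseteq D$, there is $Z\in\mathcal{H}\restriction X$ with $\langle Z\rangle\subseteq D$. $(p)$: every $\preceq$-decreasing sequence in $\mathcal{H}$ has a member of $\mathcal{H}$ that is $\preceq^*$ each term; $(p^+)$-filter: full filter with $(p)$. Strategic: whenever $X\in\mathcal{H}$ and $\alpha$ is a strategy for II in $G[X]$, some outcome of $\alpha$ lies in $\mathcal{H}$. Games for $\vec x\in E^{[<\infty]}$, $X\in E^{[\infty]}$: in $F[\vec x,X]$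 I plays $n_k\in\omega$, II plays nonzero $y_k\in\langle X\rangle$ with $n_k<\min\mathrm{supp}(y_k)$; in $G[\vec x,X]$ I plays $Y_k\in E^{[\infty]}$, $Y_k\preceq X$, II plays nonzero $y_k\in\langle Y_k\rangle$; II's moves are supported above $\vec x$ and form a block sequence; outcome $\vec x^\frown(y_k)$; $G[X]=G[\emptyset,X]$. $[\sigma]$ is the set of outcomes of plays where I follows $\sigma$. $\mathbb{S}$: nonempty perfect subtrees of $2^{<\omega}$ ordered by inclusion; $[p]$ the branches of $p$. $\mathbb{A}$ is perfectly $\mathcal{U}$-strategically Ramsey if for every $\vec x\in E^{[<\infty]}$, $X\in\mathcal{U}$ and $p\in\mathbb{S}$ there are $Y\in\mathcal{U}\restriction X$ and $q\le p$ such that either (i) I has a strategy $\sigma$ in $F[\vec x,Y]$ with $([q]\times[\sigma])\cap\mathbb{A}=\emptyset$, or (ii) for every $f\in[q]$, II has a strategy in $G[\vec x,Y]$ all of whose outcomes lie in $\mathbb{A}_f=\{Z:(f,Z)\in\mathbb{A}\}$. *)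

theory Defs
  imports Main "HOL-Library.Countable"
begin

text \<open>The vector space E over a countable field 'f with basis (e_n): finitely supported
  maps nat => 'f; a vector v has coefficient v n at e_n.\<close>

type_synonym 'f vec = "nat \<Rightarrow> 'f"

definition supp :: "'f::zero vec \<Rightarrow> nat set" where
  "supp v = {n. v n \<noteq> 0}"

definition inE :: "'f::zero vec \<Rightarrow> bool" where
  "inE v \<longleftrightarrow> finite (supp v)"

definition nzE :: "'f::zero vec \<Rightarrow> bool" where
  "nzE v \<longleftrightarrow> finite (supp v) \<and> supp v \<noteq> {}"

definition span_seq :: "(nat \<Rightarrow> 'f::field vec) \<Rightarrow> 'f vec set" where
  "span_seq X = {v. \<exists>n c. v = (\<lambda>i. \<Sum>k<n. c k * X k i)}"

definition Einf :: "(nat \<Rightarrow> 'f::field vec) set" where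
  "Einf = {X. (\<forall>n. nzE (X n)) \<and> (\<forall>n. Max (supp (X n)) < Min (supp (X (Suc n))))}"

definition Efin :: "'f::field vec list set" where
  "Efin = {xs. (\<forall>v\<in>set xs. nzE v) \<and>
                (\<forall>i. Suc i < length xs \<longrightarrow> Max (supp (xs ! i)) < Min (supp (xs ! Suc i)))}"

definition below :: "(nat \<Rightarrow> 'f::field vec) \<Rightarrow> (nat \<Rightarrow> 'f vec) \<Rightarrow> bool" (infix "\<preceq>" 50) where
  "Y \<preceq> X \<longleftrightarrow> span_seq Y \<subseteq> span_seq X"

definition below_star :: "(nat \<Rightarrow> 'f::field vec) \<Rightarrow> (nat \<Rightarrow> 'f vec) \<Rightarrow> bool" (infix "\<preceq>\<^sup>*" 50) where
  "Y \<preceq>\<^sup>* X \<longleftrightarrow> (\<exists>m. (\<lambda>n. Y (n + m)) \<preceq> X)"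

definition restr :: "(nat \<Rightarrow> 'f::field vec) set \<Rightarrow> (nat \<Rightarrow> 'f vec) \<Rightarrow> (nat \<Rightarrow> 'f vec) set"
  (infixl "\<restriction>" 60) where
  "H \<restriction> X = {Y \<in> H. Y \<preceq> X}"

definition family :: "(nat \<Rightarrow> 'f::field vec) set \<Rightarrow> bool" where
  "family H \<longleftrightarrow> H \<noteq> {} \<and> H \<subseteq> Einf \<and>
     (\<forall>Y X. Y \<in> H \<and> X \<in> Einf \<and> Y \<preceq>\<^sup>* X \<longrightarrow> X \<in> H)"

definition is_filter :: "(nat \<Rightarrow> 'f::field vec) set \<Rightarrow> bool" where
  "is_filter H \<longleftrightarrow> family H \<and> (\<forall>X\<in>H. \<forall>Y\<in>H. \<exists>Z\<in>H. Z \<preceq> X \<and> Z \<preceq> Y)"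

definition full :: "(nat \<Rightarrow> 'f::field vec) set \<Rightarrow> bool" where
  "full H \<longleftrightarrow> (\<forall>D X. X \<in> H \<and> (\<forall>Y \<in> H \<restriction> X. \<exists>Z\<in>Einf. Z \<preceq> Y \<and> span_seq Z \<subseteq> D)
      \<longrightarrow> (\<exists>Z \<in> H \<restriction> X. span_seq Z \<subseteq> D))"

definition has_p :: "(nat \<Rightarrow> 'f::field vec) set \<Rightarrow> bool" where
  "has_p H \<longleftrightarrow> (\<forall>Xs::nat \<Rightarrow> (nat \<Rightarrow> 'f vec). (\<forall>n. Xs n \<in> H) \<and> (\<forall>n. Xs (Suc n) \<preceq> Xs n)
      \<longrightarrow> (\<exists>X\<in>H. \<forall>n. X \<preceq>\<^sup>* Xs n))"

definition p_plus_filter :: "(nat \<Rightarrow> 'f::field vec) set \<Rightarrow> bool" where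
  "p_plus_filter H \<longleftrightarrow> is_filter H \<and> full H \<and> has_p H"

definition after :: "'f::field vec list \<Rightarrow> 'f vec \<Rightarrow> bool" where
  "after xs y \<longleftrightarrow> nzE y \<and> (xs = [] \<or> Max (supp (last xs)) < Min (supp y))"

definition cat_seq :: "'a list \<Rightarrow> (nat \<Rightarrow> 'a) \<Rightarrow> nat \<Rightarrow> 'a" where
  "cat_seq xs ys = (\<lambda>n. if n < length xs then xs ! n else ys (n - length xs))"

text \<open>Game F[x,X]: a strategy for I maps II's previous moves to a natural number.
  [sigma] is the set of outcomes of plays in which I follows sigma.\<close>
definition F_outcomes :: "'f::field vec list \<Rightarrow> (nat \<Rightarrow> 'f vec) \<Rightarrow> ('f vec list \<Rightarrow> nat)
    \<Rightarrow> (nat \<Rightarrow> 'f vec) set" where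
  "F_outcomes x X \<sigma> = {cat_seq x ys | ys.
      \<forall>k. ys k \<in> span_seq X \<and> after (x @ map ys [0..<k]) (ys k) \<and>
          \<sigma> (map ys [0..<k]) < Min (supp (ys k))}"

text \<open>Game G[x,X]: a strategy for II maps the list of I's moves so far (Y_0..Y_k)
  to II's k-th move; it must produce legal moves against every legal play of I.\<close>
definition II_response :: "((nat \<Rightarrow> 'f vec) list \<Rightarrow> 'f vec) \<Rightarrow> (nat \<Rightarrow> (nat \<Rightarrow> 'f vec)) \<Rightarrow> nat \<Rightarrow> 'f vec" where
  "II_response \<alpha> Ys = (\<lambda>k. \<alpha> (map Ys [0..<Suc k]))"

definition I_legal_G :: "(nat \<Rightarrow> 'f::field vec) \<Rightarrow> (nat \<Rightarrow> (nat \<Rightarrow> 'f vec)) \<Rightarrow> bool" where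
  "I_legal_G X Ys \<longleftrightarrow> (\<forall>k. Ys k \<in> Einf \<and> Ys k \<preceq> X)"

definition strategy_II_G :: "'f::field vec list \<Rightarrow> (nat \<Rightarrow> 'f vec) \<Rightarrow> ((nat \<Rightarrow> 'f vec) list \<Rightarrow> 'f vec) \<Rightarrow> bool" where
  "strategy_II_G x X \<alpha> \<longleftrightarrow> (\<forall>Ys. I_legal_G X Ys \<longrightarrow>
      (\<forall>k. II_response \<alpha> Ys k \<in> span_seq (Ys k) \<and>
           after (x @ map (II_response \<alpha> Ys) [0..<k]) (II_response \<alpha> Ys k)))"

definition G_outcomes :: "'f::field vec list \<Rightarrow> (nat \<Rightarrow> 'f vec) \<Rightarrow> ((nat \<Rightarrow> 'f vec) list \<Rightarrow> 'f vec)
    \<Rightarrow> (nat \<Rightarrow> 'f vec) set" where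
  "G_outcomes x X \<alpha> = {cat_seq x (II_response \<alpha> Ys) | Ys. I_legal_G X Ys}"

definition strategic :: "(nat \<Rightarrow> 'f::field vec) set \<Rightarrow> bool" where
  "strategic H \<longleftrightarrow> (\<forall>X \<in> H. \<forall>\<alpha>. strategy_II_G [] X \<alpha> \<longrightarrow> G_outcomes [] X \<alpha> \<inter> H \<noteq> {})"

definition perfect_tree :: "bool list set \<Rightarrow> bool" where
  "perfect_tree p \<longleftrightarrow> p \<noteq> {} \<and> (\<forall>s t. s @ t \<in> p \<longrightarrow> s \<in> p) \<and>
     (\<forall>s\<in>p. \<exists>t. s @ t @ [False] \<in> p \<and> s @ t @ [True] \<in> p)"

definition branches :: "bool list set \<Rightarrow> (nat \<Rightarrow> bool) set" where
  "branches p = {f. \<forall>n. map f [0..<n] \<in> p}"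

text \<open>Continuity of maps between countable products of discrete spaces
  (each output coordinate depends on finitely many input coordinates).\<close>
definition seq_cont :: "((nat \<Rightarrow> 'a) \<Rightarrow> (nat \<Rightarrow> 'b)) \<Rightarrow> bool" where
  "seq_cont h \<longleftrightarrow> (\<forall>x n. \<exists>k. \<forall>y. (\<forall>i<k. y i = x i) \<longrightarrow> h y n = h x n)"

text \<open>Analytic subsets of 2^omega x E^omega (E discrete): empty or continuous images of
  the Baire space.\<close>
definition analytic :: "((nat \<Rightarrow> bool) \<times> (nat \<Rightarrow> 'f vec)) set \<Rightarrow> bool" where
  "analytic A \<longleftrightarrow> A = {} \<or> (\<exists>g :: (nat \<Rightarrow> nat) \<Rightarrow> (nat \<Rightarrow> bool) \<times> (nat \<Rightarrow> 'f vec).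
      seq_cont (fst \<circ> g) \<and> seq_cont (snd \<circ> g) \<and> A = range g)"

definition slice_at :: "((nat \<Rightarrow> bool) \<times> 'b) set \<Rightarrow> (nat \<Rightarrow> bool) \<Rightarrow> 'b set" where
  "slice_at A f = {Z. (f, Z) \<in> A}"

definition perfectly_strat_Ramsey ::
  "(nat \<Rightarrow> 'f::field vec) set \<Rightarrow> ((nat \<Rightarrow> bool) \<times> (nat \<Rightarrow> 'f vec)) set \<Rightarrow> bool" where
  "perfectly_strat_Ramsey U A \<longleftrightarrow>
    (\<forall>x \<in> Efin. \<forall>X \<in> U. \<forall>p. perfect_tree p \<longrightarrow>
      (\<exists>Y \<in> U \<restriction> X. \<exists>q. perfect_tree q \<and> q \<subseteq> p \<and>
         ((\<exists>\<sigma>. (branches q \<times> F_outcomes x Y \<sigma>) \<inter> A = {}) \<or>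
          (\<forall>f \<in> branches q. \<exists>\<alpha>. strategy_II_G x Y \<alpha> \<and> G_outcomes x Y \<alpha> \<subseteq> slice_at A f))))"

end

theory Submission
  imports Defs "HOL-Library.Countable_Set" "HOL-Library.Sublist"
begin

text \<open>Everything is combinatorial forcing with conditions \<open>(Y, q)\<close>, where \<open>Y \<in> U\<close> and \<open>q\<close> is a perfect
  tree. Property \<open>(p)\<close> together with Sacks fusion lets one condition decide countably many hereditary
  predicates, up to passing to the nodes of some level of \<open>q\<close>.

  The heart is a parametrized pigeonhole principle for a family \<open>D f \<subseteq> E\<close> with \<open>{f. v \<in> D f}\<close> open:
  after shrinking, either the span of \<open>Y\<close> misses every \<open>D f\<close>, or every block sequence below \<open>Y\<close> meets
  every \<open>D f\<close>. If below every condition some \<open>f\<close> and some \<open>Z \<in> U\<close> have a span missing \<open>D f\<close>, then II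
  can build in the game \<open>G\<close> a sequence along with a perfect tree whose branches it misses, and
  strategicity puts an outcome into \<open>U\<close>. Otherwise no member of \<open>U\<close> belongs to the set \<open>R\<close> of all \<open>Z\<close>
  whose span misses \<open>D f\<close> for some branch \<open>f\<close>. As \<open>R\<close> is closed (compactness of the branches), II
  cannot have a strategy to stay in \<open>R\<close>, and so some \<open>Y \<in> U\<close> has no block sequence of \<open>R\<close> below it.

  This principle drives the one-step analysis of open games. For \<open>A = range g\<close> one decides for all
  finite \<open>x\<close> and \<open>s\<close> whether I can avoid \<open>g ` [s]\<close> from \<open>x\<close>. Where I cannot, the open dichotomy gives II
  a strategy to reach, in finitely many moves, a position at which I cannot avoid \<open>g ` [s @ [j]]\<close> for
  some \<open>j\<close>; the concatenation of these strategies defines \<open>c\<close> with \<open>g c = (f, z)\<close> for the outcome \<open>z\<close>.\<close>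

section \<open>Spans of block sequences\<close>

abbreviation tail :: "nat \<Rightarrow> (nat \<Rightarrow> 'a) \<Rightarrow> nat \<Rightarrow> 'a" where
  "tail m Y \<equiv> (\<lambda>n. Y (n + m))"

text \<open>Padding a list with zero vectors makes its span an instance of \<open>span_seq\<close>,
  so that no separate theory of finite spans arises.\<close>

definition fspan :: "'f::field vec list \<Rightarrow> 'f vec set" where
  "fspan a = span_seq (cat_seq a (\<lambda>_ _. 0))"

lemma span_seqI: "(\<lambda>i. \<Sum>k<n. c k * X k i) \<in> span_seq X"
  by (auto simp: span_seq_def)

lemma zero_in_span: "(\<lambda>_. 0) \<in> span_seq X"
  using span_seqI[where n=0 and X=X] by simp

lemma span_seq_sum_mult:
  assumes "u \<in> span_seq X" "v \<in> span_seq X"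
  shows "(\<lambda>i. u i + d * v i) \<in> span_seq X"
proof -
  obtain n c where u: "u = (\<lambda>i. \<Sum>k<n. c k * X k i)"
    using assms by (auto simp: span_seq_def)
  obtain m e where v: "v = (\<lambda>i. \<Sum>k<m. e k * X k i)"
    using assms by (auto simp: span_seq_def)
  let ?N = "max n m"
  have "(\<Sum>k<n. c k * X k i) = (\<Sum>k<?N. (if k < n then c k else 0) * X k i)" for i
    by (rule sum.mono_neutral_cong_left) auto
  moreover have "(\<Sum>k<m. e k * X k i) = (\<Sum>k<?N. (if k < m then e k else 0) * X k i)" for i
    by (rule sum.mono_neutral_cong_left) auto
  ultimately have "(\<lambda>i. u i + d * v i) =
     (\<lambda>i. \<Sum>k<?N. ((if k < n then c k else 0) + d * (if k < m then e k else 0)) * X k i)"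
    unfolding u v by (simp add: sum.distrib sum_distrib_left algebra_simps)
  then show ?thesis
    by (metis (no_types) span_seqI)
qed

lemma span_seq_subset:
  assumes "\<And>n. X n \<in> span_seq Y"
  shows "span_seq X \<subseteq> span_seq Y"
proof
  fix v assume "v \<in> span_seq X"
  then obtain n c where v: "v = (\<lambda>i. \<Sum>k<n. c k * X k i)"
    by (auto simp: span_seq_def)
  have "(\<lambda>i. \<Sum>k<n. c k * X k i) \<in> span_seq Y"
  proof (induction n)
    case 0
    then show ?case by (simp add: zero_in_span)
  next
    case (Suc n)
    from span_seq_sum_mult[OF this assms[of n], of "c n"] show ?case by simp
  qed
  then show "v \<in> span_seq Y" by (simp add: v)
qed

lemma in_span_seq: "X n \<in> span_seq X"
proof -
  have "X n = (\<lambda>i. \<Sum>k<Suc n. (if k = n then 1 else 0) * X k i)"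
    by (rule ext) (simp add: if_distrib[where f="\<lambda>x. x * _"] cong: if_cong)
  then show ?thesis by (metis (no_types) span_seqI)
qed

lemma tail_below: "tail m Y \<preceq> Y"
  unfolding below_def by (rule span_seq_subset) (rule in_span_seq)

lemma below_trans: "X \<preceq> Y \<Longrightarrow> Y \<preceq> Z \<Longrightarrow> X \<preceq> Z"
  by (auto simp: below_def)

lemma below_imp_star: "X \<preceq> Y \<Longrightarrow> X \<preceq>\<^sup>* Y"
  unfolding below_star_def by (rule exI[of _ 0]) simp

lemma span_cat_mono:
  assumes "Z' \<preceq> Z"
  shows "span_seq (cat_seq a Z') \<subseteq> span_seq (cat_seq a Z)"
proof (rule span_seq_subset)
  fix n
  have "Z k \<in> span_seq (cat_seq a Z)" for k
    using in_span_seq[of "cat_seq a Z" "k + length a"] by (simp add: cat_seq_def)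
  then have "span_seq Z \<subseteq> span_seq (cat_seq a Z)"
    by (rule span_seq_subset)
  moreover have "Z' k \<in> span_seq Z" for k
    using assms in_span_seq[of Z' k] by (auto simp: below_def)
  moreover have "n < length a \<Longrightarrow> a ! n \<in> span_seq (cat_seq a Z)"
    using in_span_seq[of "cat_seq a Z" n] by (simp add: cat_seq_def)
  ultimately show "cat_seq a Z' n \<in> span_seq (cat_seq a Z)"
    by (auto simp: cat_seq_def)
qed

text \<open>Moving the first vector of \<open>Z\<close> into the finite part leaves the sequence as
  it is; this is how the stem grows in the pigeonhole argument.\<close>

lemma cat_seq_snoc: "cat_seq (a @ [Z 0]) (tail 1 Z) = cat_seq a Z"
  by (rule ext) (auto simp: cat_seq_def nth_append Suc_diff_Suc)

lemma fspan_subset_span: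
  assumes "set a \<subseteq> span_seq Z"
  shows "fspan a \<subseteq> span_seq Z"
  unfolding fspan_def
  by (rule span_seq_subset)
    (use assms in \<open>auto simp: cat_seq_def zero_in_span dest: nth_mem\<close>)

lemma fspan_subset_cat: "fspan a \<subseteq> span_seq (cat_seq a Z)"
proof (rule fspan_subset_span, rule subsetI)
  fix v assume "v \<in> set a"
  then obtain n where "n < length a" "v = a ! n" by (auto simp: in_set_conv_nth)
  then show "v \<in> span_seq (cat_seq a Z)"
    using in_span_seq[of "cat_seq a Z" n] by (simp add: cat_seq_def)
qed

lemma fspan_mono: "set a \<subseteq> set b \<Longrightarrow> fspan a \<subseteq> fspan b"
proof (rule fspan_subset_span[where Z="cat_seq b (\<lambda>_ _. 0)", folded fspan_def], rule subsetI)
  fix v assume "set a \<subseteq> set b" "v \<in> set a"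
  then obtain n where "n < length b" "v = b ! n" by (metis in_set_conv_nth subsetD)
  then show "v \<in> fspan b"
    using in_span_seq[of "cat_seq b (\<lambda>_ _. 0)" n] by (simp add: cat_seq_def fspan_def)
qed

lemma span_seq_fspan:
  assumes "v \<in> span_seq Z"
  obtains n where "v \<in> fspan (map Z [0..<n])"
proof -
  obtain n c where v: "v = (\<lambda>i. \<Sum>k<n. c k * Z k i)"
    using assms by (auto simp: span_seq_def)
  have "v = (\<lambda>i. \<Sum>k<n. c k * cat_seq (map Z [0..<n]) (\<lambda>_ _. 0) k i)"
    unfolding v by (rule ext, rule sum.cong) (auto simp: cat_seq_def)
  then have "v \<in> fspan (map Z [0..<n])"
    unfolding fspan_def by (metis (no_types) span_seqI)
  then show thesis by (rule that)
qed

section \<open>Supports, tails and almost inclusion of block sequences\<close>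

lemma Einf_nz: "Y \<in> Einf \<Longrightarrow> nzE (Y n)"
  by (simp add: Einf_def)

lemma tail_Einf: "Y \<in> Einf \<Longrightarrow> tail m Y \<in> Einf"
  by (simp add: Einf_def)

lemma nzE_Min_le_Max: "nzE v \<Longrightarrow> Min (supp v) \<le> Max (supp v)"
  by (simp add: nzE_def)

lemma Einf_Max_less_Min:
  assumes "Y \<in> Einf" "j < k"
  shows "Max (supp (Y j)) < Min (supp (Y k))"
  using assms(2)
proof (induction k)
  case (Suc k)
  have "Max (supp (Y k)) < Min (supp (Y (Suc k)))"
    using assms(1) by (auto simp: Einf_def)
  moreover have "Min (supp (Y k)) \<le> Max (supp (Y k))"
    using nzE_Min_le_Max Einf_nz assms(1) by blast
  ultimately show ?case
    using Suc by (cases "j = k") auto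
qed simp

lemma Einf_le_Min:
  assumes "Y \<in> Einf"
  shows "n \<le> Min (supp (Y n))"
proof (induction n)
  case (Suc n)
  then show ?case
    using Einf_Max_less_Min[OF assms, of n "Suc n"] nzE_Min_le_Max[OF Einf_nz[OF assms], of n] by simp
qed simp

lemma span_supp:
  assumes "v \<in> span_seq Y" "i \<in> supp v"
  obtains k where "i \<in> supp (Y k)"
proof -
  obtain n c where v: "v = (\<lambda>i. \<Sum>k<n. c k * Y k i)"
    using assms by (auto simp: span_seq_def)
  have "(\<Sum>k<n. c k * Y k i) \<noteq> 0" using assms(2) by (simp add: v supp_def)
  then obtain k where "c k * Y k i \<noteq> 0" by (rule sum.not_neutral_contains_not_neutral)
  then have "i \<in> supp (Y k)" by (auto simp: supp_def)
  then show thesis by (rule that)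
qed

lemma span_cases:
  assumes "Y \<in> Einf" "v \<in> span_seq Y"
  shows "v = (\<lambda>_. 0) \<or> nzE v"
proof -
  obtain n c where v: "v = (\<lambda>i. \<Sum>k<n. c k * Y k i)"
    using assms(2) by (auto simp: span_seq_def)
  have "supp v \<subseteq> (\<Union>k<n. supp (Y k))"
  proof
    fix i assume "i \<in> supp v"
    then have "(\<Sum>k<n. c k * Y k i) \<noteq> 0" by (simp add: v supp_def)
    then obtain k where "k \<in> {..<n}" "c k * Y k i \<noteq> 0"
      by (rule sum.not_neutral_contains_not_neutral)
    then show "i \<in> (\<Union>k<n. supp (Y k))" by (auto simp: supp_def)
  qed
  moreover have "finite (\<Union>k<n. supp (Y k))"
    using Einf_nz[OF assms(1)] by (auto simp: nzE_def)
  ultimately have "finite (supp v)" by (rule finite_subset)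
  then show ?thesis by (auto simp: nzE_def supp_def)
qed

lemma tail_span_Min:
  assumes "Y \<in> Einf" "v \<in> span_seq (tail m Y)" "nzE v"
  shows "m \<le> Min (supp v)"
proof -
  have "Min (supp v) \<in> supp v" using assms(3) by (simp add: nzE_def)
  then obtain k where k: "Min (supp v) \<in> supp (Y (k + m))"
    using span_supp[OF assms(2)] by metis
  have "k + m \<le> Min (supp (Y (k + m)))" by (rule Einf_le_Min[OF assms(1)])
  also have "\<dots> \<le> Min (supp v)"
    using k Einf_nz[OF assms(1), of "k + m"] by (simp add: nzE_def)
  finally show ?thesis by simp
qed

text \<open>At the index \<open>Max (supp (Y j))\<close> with \<open>j < m\<close> only
  \<open>Y j\<close> can contribute: later vectors start beyond it, and the earlier coefficients
  vanish by induction. But \<open>v\<close> is zero there, so its coefficient at \<open>Y j\<close>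
  is zero as well.\<close>

lemma span_tailI:
  assumes Y: "Y \<in> Einf" and v: "v \<in> span_seq Y" and nz: "nzE v"
    and gt: "Max (supp (Y m)) < Min (supp v)"
  shows "v \<in> span_seq (tail m Y)"
proof -
  obtain n c where veq: "v = (\<lambda>i. \<Sum>k<n. c k * Y k i)"
    using v by (auto simp: span_seq_def)
  have c0: "c j = 0" if "j < n" "j < m" for j
    using that
  proof (induction j rule: less_induct)
    case (less j)
    let ?i = "Max (supp (Y j))"
    have i: "?i \<in> supp (Y j)" using Einf_nz[OF Y, of j] by (simp add: nzE_def)
    have "c k * Y k ?i = 0" if "k < n" "k \<noteq> j" for k
    proof (cases "k < j")
      case True
      then show ?thesis using less by simp
    next
      case False
      then have "?i < Min (supp (Y k))" using Einf_Max_less_Min[OF Y] that by simp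
      then have "?i \<notin> supp (Y k)" using Einf_nz[OF Y, of k] by (auto simp: nzE_def)
      then show ?thesis by (simp add: supp_def)
    qed
    then have others: "\<forall>k\<in>{..<n} - {j}. c k * Y k ?i = 0" by simp
    have "v ?i = c j * Y j ?i"
      unfolding veq using less.prems(1) by (subst sum.remove[of _ j]) (use sum.neutral[OF others] in auto)
    moreover have "?i < Min (supp v)"
      using Einf_Max_less_Min[OF Y less.prems(2)] gt nzE_Min_le_Max[OF Einf_nz[OF Y], of m] by simp
    then have "?i \<notin> supp v" using nz by (auto simp: nzE_def)
    ultimately show ?case using i by (simp add: supp_def)
  qed
  have "v = (\<lambda>i. \<Sum>k<n-m. c (k+m) * Y (k+m) i)"
  proof
    fix i
    have "v i = (\<Sum>k\<in>{m..<n}. c k * Y k i)"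
      unfolding veq by (rule sum.mono_neutral_right) (auto simp: c0)
    also have "\<dots> = (\<Sum>k<n-m. c (k+m) * Y (k+m) i)"
      by (rule sum.reindex_bij_witness[where i="\<lambda>k. k + m" and j="\<lambda>k. k - m"]) auto
    finally show "v i = (\<Sum>k<n-m. c (k+m) * Y (k+m) i)" .
  qed
  then show ?thesis using span_seqI[where n="n - m" and c="\<lambda>k. c (k+m)" and X="tail m Y"] by simp
qed

text \<open>A bound on the minimum of the support replaces the choice of a tail. Bounds combine by
  \<open>max\<close>, and in the game F player I can enforce them by the numbers played.\<close>

lemma below_star_iff:
  assumes "Z \<in> Einf"
  shows "Z \<preceq>\<^sup>* Y \<longleftrightarrow> (\<exists>N. \<forall>v\<in>span_seq Z. nzE v \<and> N < Min (supp v) \<longrightarrow> v \<in> span_seq Y)"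
proof
  assume "Z \<preceq>\<^sup>* Y"
  then obtain m where "tail m Z \<preceq> Y" by (auto simp: below_star_def)
  then show "\<exists>N. \<forall>v\<in>span_seq Z. nzE v \<and> N < Min (supp v) \<longrightarrow> v \<in> span_seq Y"
    using span_tailI[OF assms] by (metis below_def subsetD)
next
  assume "\<exists>N. \<forall>v\<in>span_seq Z. nzE v \<and> N < Min (supp v) \<longrightarrow> v \<in> span_seq Y"
  then obtain N where N: "\<And>v. v \<in> span_seq Z \<Longrightarrow> nzE v \<Longrightarrow> N < Min (supp v) \<Longrightarrow> v \<in> span_seq Y"
    by blast
  have "v \<in> span_seq Y" if v: "v \<in> span_seq (tail (Suc N) Z)" for v
  proof -
    have "v \<in> span_seq Z" using v tail_below[where m="Suc N" and Y=Z] by (auto simp: below_def)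
    moreover have "nzE v \<Longrightarrow> N < Min (supp v)" using tail_span_Min[OF assms v] by simp
    ultimately show ?thesis
      using span_cases[OF assms, of v] N zero_in_span by blast
  qed
  then show "Z \<preceq>\<^sup>* Y" unfolding below_star_def below_def by blast
qed

lemma below_star_trans:
  assumes "X \<preceq>\<^sup>* Y" "Y \<preceq>\<^sup>* Z" "X \<in> Einf" "Y \<in> Einf"
  shows "X \<preceq>\<^sup>* Z"
proof -
  obtain N where N: "\<forall>v\<in>span_seq X. nzE v \<and> N < Min (supp v) \<longrightarrow> v \<in> span_seq Y"
    using assms below_star_iff by blast
  obtain M where M: "\<forall>v\<in>span_seq Y. nzE v \<and> M < Min (supp v) \<longrightarrow> v \<in> span_seq Z"
    using assms below_star_iff by blast
  have "\<forall>v\<in>span_seq X. nzE v \<and> max N M < Min (supp v) \<longrightarrow> v \<in> span_seq Z"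
    using N M by simp
  then show ?thesis using assms(3) below_star_iff by blast
qed

lemma star_tail: "Y \<preceq>\<^sup>* tail m Y"
  unfolding below_star_def by (metis below_def order_refl)

text \<open>A vector is recovered from the list of its coefficients up to the maximum of its
  support. Countability lets fusion treat all finite sequences of vectors.\<close>

lemma countable_nzE: "countable {v :: 'f::{field,countable} vec. nzE v}"
proof (rule countable_subset)
  show "{v :: 'f vec. nzE v} \<subseteq> range (\<lambda>xs n. if n < length xs then xs ! n else 0)"
  proof
    fix v :: "'f vec" assume "v \<in> {v. nzE v}"
    then have fin: "finite (supp v)" by (simp add: nzE_def)
    have "n \<notin> supp v" if "\<not> n < Suc (Max (supp v))" for n
      using that Max_ge[OF fin, of n] by auto
    then have "v n = 0" if "\<not> n < Suc (Max (supp v))" for n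
      using that by (simp add: supp_def)
    then have "v = (\<lambda>n. if n < length (map v [0..<Suc (Max (supp v))])
        then map v [0..<Suc (Max (supp v))] ! n else 0)"
      by (auto simp: fun_eq_iff simp del: upt_Suc)
    then show "v \<in> range (\<lambda>xs n. if n < length xs then xs ! n else 0)" by blast
  qed
qed simp

section \<open>Perfect trees\<close>

text \<open>The restriction of a Sacks condition to a node; the initial segments of \<open>t\<close>
  are kept so that it is again a tree.\<close>

definition subtree :: "bool list set \<Rightarrow> bool list \<Rightarrow> bool list set" where
  "subtree q t = {u \<in> q. prefix u t \<or> prefix t u}"

lemma perfect_prefix: "perfect_tree q \<Longrightarrow> t \<in> q \<Longrightarrow> prefix s t \<Longrightarrow> s \<in> q"
  by (auto simp: perfect_tree_def prefix_def)

lemma perfect_Nil: "perfect_tree q \<Longrightarrow> [] \<in> q"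
  using perfect_prefix[of q _ "[]"] by (auto simp: perfect_tree_def)

lemma perfect_split:
  assumes "perfect_tree q" "s \<in> q"
  obtains t where "s @ t @ [False] \<in> q" "s @ t @ [True] \<in> q"
  using assms unfolding perfect_tree_def by blast

lemma perfect_extend:
  assumes "perfect_tree q" "s \<in> q" "length s \<le> n"
  obtains u where "u \<in> q" "prefix s u" "length u = n"
proof -
  have "\<exists>u\<in>q. prefix s u \<and> length u = n"
    using assms(3)
  proof (induction n)
    case 0
    then show ?case using assms(2) by auto
  next
    case (Suc n)
    show ?case
    proof (cases "length s = Suc n")
      case False
      with Suc obtain u where u: "u \<in> q" "prefix s u" "length u = n" by auto
      obtain t where "u @ t @ [False] \<in> q" using perfect_split[OF assms(1) u(1)] .
      then have "take (Suc n) (u @ t @ [False]) \<in> q"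
        using perfect_prefix[OF assms(1)] take_is_prefix by blast
      moreover have "prefix s (take (Suc n) (u @ t @ [False]))"
        using u by (auto simp: prefix_def)
      ultimately show ?thesis using u(3) by (intro bexI) auto
    qed (use assms(2) in auto)
  qed
  then show thesis using that by blast
qed

lemma subtree_subset: "subtree q t \<subseteq> q"
  by (auto simp: subtree_def)

lemma subtree_Nil: "subtree q [] = q"
  by (auto simp: subtree_def)

lemma subtree_mono: "q' \<subseteq> q \<Longrightarrow> prefix t t' \<Longrightarrow> subtree q' t' \<subseteq> subtree q t"
  by (auto simp: subtree_def dest: prefix_same_cases prefix_order.trans)

lemma perfect_subtree:
  assumes "perfect_tree q" "t \<in> q"
  shows "perfect_tree (subtree q t)"
proof -
  have "\<exists>w. s @ w @ [False] \<in> subtree q t \<and> s @ w @ [True] \<in> subtree q t" if s: "s \<in> subtree q t" for s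
  proof (cases "prefix t s")
    case True
    obtain w where "s @ w @ [False] \<in> q" "s @ w @ [True] \<in> q"
      using perfect_split[OF assms(1)] s by (metis (no_types) subtree_subset subsetD)
    then show ?thesis using True by (auto simp: subtree_def intro!: exI[of _ w])
  next
    case False
    then obtain r where r: "t = s @ r" using s by (auto simp: subtree_def prefix_def)
    obtain w where "t @ w @ [False] \<in> q" "t @ w @ [True] \<in> q"
      using perfect_split[OF assms] .
    then show ?thesis by (auto simp: subtree_def r intro!: exI[of _ "r @ w"])
  qed
  moreover have "s \<in> subtree q t" if "s @ w \<in> subtree q t" for s w
    using that perfect_prefix[OF assms(1), of "s @ w" s]
    using prefix_same_cases[of s "s @ w" t] by (auto simp: subtree_def dest: append_prefixD)
  moreover have "t \<in> subtree q t" using assms(2) by (simp add: subtree_def)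
  ultimately show ?thesis unfolding perfect_tree_def by blast
qed

text \<open>\<open>q'\<close> has a node of length \<open>length t\<close>, and the only node of
  that length comparable with \<open>t\<close> is \<open>t\<close> itself.\<close>

lemma stem_in_subtree:
  assumes "perfect_tree q'" "q' \<subseteq> subtree q t"
  shows "t \<in> q'"
proof -
  obtain u where u: "u \<in> q'" "length u = length t"
    using perfect_extend[OF assms(1) perfect_Nil[OF assms(1)], of "length t"] by auto
  then have "prefix u t \<or> prefix t u" using assms(2) by (auto simp: subtree_def)
  then show ?thesis using u by (auto simp: prefix_def)
qed

lemma branches_mono: "q' \<subseteq> q \<Longrightarrow> branches q' \<subseteq> branches q"
  by (auto simp: branches_def)

lemma prefix_map_upt: "m \<le> n \<Longrightarrow> prefix (map f [0..<m]) (map f [0..<n])"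
  by (metis le_add_diff_inverse map_append prefixI upt_add_eq_append zero_le)

lemma prefix_length_eq: "length s = length t \<Longrightarrow> prefix s t \<longleftrightarrow> s = t"
  by (auto simp: prefix_def)

lemma branches_subtree:
  "f \<in> branches (subtree q t) \<longleftrightarrow> f \<in> branches q \<and> map f [0..<length t] = t"
proof
  assume f: "f \<in> branches (subtree q t)"
  then have "map f [0..<length t] \<in> subtree q t" by (simp add: branches_def)
  then have "map f [0..<length t] = t"
    by (auto simp: subtree_def prefix_length_eq)
  then show "f \<in> branches q \<and> map f [0..<length t] = t"
    using f branches_mono[OF subtree_subset, of q t] by auto
next
  assume f: "f \<in> branches q \<and> map f [0..<length t] = t"
  have "prefix (map f [0..<n]) t \<or> prefix t (map f [0..<n])" for n
    using f prefix_map_upt[of n "length t" f] prefix_map_upt[of "length t" n f] by (cases "n \<le> length t") auto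
  with f show "f \<in> branches (subtree q t)" by (auto simp: branches_def subtree_def)
qed

lemma branches_subtree_self: "f \<in> branches q \<Longrightarrow> f \<in> branches (subtree q (map f [0..<n]))"
  by (simp add: branches_subtree)

lemma branches_node: "f \<in> branches q \<Longrightarrow> map f [0..<n] \<in> q"
  by (simp add: branches_def)

lemma map_upt_eq_iff: "map f [0..<n] = map g [0..<n] \<longleftrightarrow> (\<forall>i<n. f i = g i)"
  by auto

text \<open>Koenig's lemma: the nodes \<open>T m\<close> are chosen so that infinitely many
  \<open>F n\<close> pass through each of them. Hence the limit agrees with \<open>F n\<close> up to
  \<open>m\<close> for arbitrarily large \<open>n\<close>.\<close>

lemma branches_compact:
  fixes F :: "nat \<Rightarrow> nat \<Rightarrow> bool"
  assumes "\<And>n. F n \<in> branches q"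
  obtains f where "f \<in> branches q" "\<And>m k. \<exists>n\<ge>k. \<forall>i<m. F n i = f i"
proof -
  let ?P = "\<lambda>m t. length t = m \<and> infinite {n. map (F n) [0..<m] = t}"
  have "\<exists>T. \<forall>m. ?P m (T m) \<and> (\<exists>b. T (Suc m) = T m @ [b])"
  proof (rule dependent_nat_choice)
    have "infinite {n. map (F n) [0..<0] = []}" by simp
    then show "\<exists>t. ?P 0 t" by blast
  next
    fix t m assume P: "?P m t"
    have "{n. map (F n) [0..<m] = t} = {n. map (F n) [0..<Suc m] = t @ [False]}
        \<union> {n. map (F n) [0..<Suc m] = t @ [True]}" by auto
    with P have "infinite {n. map (F n) [0..<Suc m] = t @ [False]}
        \<or> infinite {n. map (F n) [0..<Suc m] = t @ [True]}" by (metis finite_Un)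
    then obtain b where "infinite {n. map (F n) [0..<Suc m] = t @ [b]}" by blast
    with P show "\<exists>t'. ?P (Suc m) t' \<and> (\<exists>b. t' = t @ [b])"
      by (intro exI[of _ "t @ [b]"]) (simp del: upt_Suc)
  qed
  then obtain T where T: "\<And>m. ?P m (T m)" "\<And>m. \<exists>b. T (Suc m) = T m @ [b]" by blast
  define f where "f i = T (Suc i) ! i" for i
  have Tf: "T m = map f [0..<m]" for m
  proof (induction m)
    case 0
    then show ?case using T(1)[of 0] by simp
  next
    case (Suc m)
    obtain b where b: "T (Suc m) = T m @ [b]" using T(2) by blast
    then have "f m = b" using T(1)[of m] by (simp add: f_def nth_append)
    then show ?case using b Suc by simp
  qed
  have agree: "\<exists>n\<ge>k. \<forall>i<m. F n i = f i" for m k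
  proof -
    have "infinite {n. map (F n) [0..<m] = map f [0..<m]}" using T(1)[of m] Tf by simp
    then obtain n where "n \<ge> k" "map (F n) [0..<m] = map f [0..<m]"
      by (metis (mono_tags, lifting) infinite_nat_iff_unbounded_le mem_Collect_eq)
    then show ?thesis unfolding map_upt_eq_iff by blast
  qed
  have "map f [0..<m] \<in> q" for m
  proof -
    obtain n where "\<forall>i<m. F n i = f i" using agree by blast
    then have "map (F n) [0..<m] = map f [0..<m]" by (simp only: map_upt_eq_iff)
    moreover have "map (F n) [0..<m] \<in> q" by (rule branches_node[OF assms])
    ultimately show ?thesis by (simp only:)
  qed
  then show thesis using that[of f] agree by (auto simp: branches_def)
qed

lemma distinct_extensions_split:
  fixes u v :: "bool list"
  assumes "\<not> prefix u v" "\<not> prefix v u" "prefix s u" "prefix s v"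
  obtains w where "(prefix (s @ w @ [False]) u \<and> prefix (s @ w @ [True]) v) \<or>
    (prefix (s @ w @ [True]) u \<and> prefix (s @ w @ [False]) v)"
proof -
  obtain u' v' where uv: "u = s @ u'" "v = s @ v'" using assms by (auto simp: prefix_def)
  then have "u' \<parallel> v'" using assms by (auto simp: parallel_def)
  then obtain as b bs c cs where "b \<noteq> c" "u' = as @ b # bs" "v' = as @ c # cs"
    using parallel_decomp[OF \<open>u' \<parallel> v'\<close>] by metis
  then show thesis using that[of as] uv by (cases b; cases c) auto
qed

text \<open>These are the fronts of a fusion: \<open>S (Suc n)\<close> lies above \<open>S n\<close>
  and splits each of its nodes, so their downward closure is perfect. Finiteness of
  \<open>S n\<close> bounds the lengths of its nodes, which forces every branch through one of
  them.\<close>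

lemma perfect_scheme:
  fixes S :: "nat \<Rightarrow> bool list set"
  assumes fin: "\<And>n. finite (S n)" and ne: "S 0 \<noteq> {}"
    and prev: "\<And>n t. t \<in> S (Suc n) \<Longrightarrow> \<exists>s\<in>S n. prefix s t"
    and split: "\<And>n s. s \<in> S n \<Longrightarrow> \<exists>t\<in>S (Suc n). \<exists>u\<in>S (Suc n). prefix s t \<and> prefix s u \<and> \<not> prefix t u \<and> \<not> prefix u t"
  defines "q \<equiv> {u. \<exists>n. \<exists>t\<in>S n. prefix u t}"
  shows "perfect_tree q" and "f \<in> branches q \<Longrightarrow> \<exists>t\<in>S n. map f [0..<length t] = t"
proof -
  have "\<exists>w. s @ w @ [False] \<in> q \<and> s @ w @ [True] \<in> q" if s: "s \<in> q" for s
  proof -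
    obtain n t where t: "t \<in> S n" "prefix s t" using s by (auto simp: q_def)
    then obtain u v where uv: "u \<in> S (Suc n)" "v \<in> S (Suc n)" "prefix s u" "prefix s v"
      "\<not> prefix u v" "\<not> prefix v u" using split[OF t(1)] prefix_order.trans by metis
    then obtain w where "(prefix (s @ w @ [False]) u \<and> prefix (s @ w @ [True]) v) \<or>
      (prefix (s @ w @ [True]) u \<and> prefix (s @ w @ [False]) v)"
      using distinct_extensions_split by metis
    then show ?thesis unfolding q_def using uv by blast
  qed
  moreover have "s \<in> q" if "s @ w \<in> q" for s w
    using that unfolding q_def by (auto dest: append_prefixD)
  moreover have "q \<noteq> {}" using ne by (auto simp: q_def)
  ultimately show "perfect_tree q" unfolding perfect_tree_def by blast
next
  assume f: "f \<in> branches q"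
  define m where "m = Max (insert 0 (length ` S n))"
  have m: "length t \<le> m" if "t \<in> S n" for t using that fin[of n] by (simp add: m_def)
  have prev': "\<exists>s\<in>S i. prefix s t" if "t \<in> S (i + k)" for i k t
    using that
  proof (induction k arbitrary: t)
    case (Suc k)
    then show ?case using prev[of t "i + k"] prefix_order.trans by fastforce
  qed auto
  have forth: "\<exists>t\<in>S (i + k). prefix s t" if "s \<in> S i" for i k s
  proof (induction k)
    case (Suc k)
    then show ?case using split[of _ "i + k"] prefix_order.trans by (metis add_Suc_right)
  qed (use that in auto)
  obtain j t where t: "t \<in> S j" "prefix (map f [0..<m]) t"
    using branches_node[OF f, of m] by (auto simp: q_def)
  \<comment> \<open>The node \<open>t\<close> found above an initial segment of \<open>f\<close> may
    sit at an earlier or a later front than \<open>n\<close>; moving forth or back puts it and a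
    node of \<open>S n\<close> below a common \<open>t'\<close>.\<close>
  have "\<exists>t'. (\<exists>s\<in>S n. prefix s t') \<and> prefix t t'"
  proof (cases "n \<le> j")
    case True
    then show ?thesis using prev'[of t n "j - n"] t(1) by auto
  next
    case False
    then show ?thesis using forth[of t j "n - j"] t(1) by auto
  qed
  then obtain t' s where s: "s \<in> S n" "prefix s t'" "prefix (map f [0..<m]) t'"
    using t prefix_order.trans by blast
  then have "prefix s (map f [0..<m])"
    using prefix_length_prefix[of s t' "map f [0..<m]"] m[of s] by simp
  then have "map f [0..<length s] = s"
    using m[OF s(1)] by (metis prefix_length_prefix prefix_map_upt prefix_order.antisym
        length_map length_upt diff_zero order_refl)
  then show "\<exists>t\<in>S n. map f [0..<length t] = t" using s(1) by blast
qed

section \<open>Games and conditions\<close>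

text \<open>A strategy for II given by a state machine: \<open>P st xs\<close> says that the state \<open>st\<close> is admissible
  at the position \<open>xs\<close>, and \<open>R st y st'\<close> that the move \<open>y\<close> may change the state to \<open>st'\<close>.\<close>

lemma strategy_from_states:
  fixes x :: "'f::field vec list" and P :: "'s \<Rightarrow> 'f vec list \<Rightarrow> bool"
  assumes init: "P st0 x"
    and step: "\<And>st xs V. P st xs \<Longrightarrow> V \<in> Einf \<Longrightarrow> V \<preceq> Y \<Longrightarrow>
      \<exists>y\<in>span_seq V. after xs y \<and> (\<exists>st'. R st y st' \<and> P st' (xs @ [y]))"
  obtains \<alpha> where "strategy_II_G x Y \<alpha>"
    "\<And>z. z \<in> G_outcomes x Y \<alpha> \<Longrightarrow> \<exists>ys S. z = cat_seq x ys \<and> S 0 = st0 \<and>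
      (\<forall>k. ys k \<in> span_seq Y \<and> P (S k) (x @ map ys [0..<k]) \<and> R (S k) (ys k) (S (Suc k)))"
proof -
  have "\<exists>y st'. P st xs \<and> V \<in> Einf \<and> V \<preceq> Y \<longrightarrow>
      y \<in> span_seq V \<and> after xs y \<and> R st y st' \<and> P st' (xs @ [y])" for st xs V
    using step by blast
  then obtain mv nx where mvnx: "\<And>st xs V. P st xs \<Longrightarrow> V \<in> Einf \<Longrightarrow> V \<preceq> Y \<Longrightarrow>
      mv st xs V \<in> span_seq V \<and> after xs (mv st xs V) \<and> R st (mv st xs V) (nx st xs V) \<and>
      P (nx st xs V) (xs @ [mv st xs V])"
    by metis
  \<comment> \<open>The strategy is only told the moves of I, so \<open>M\<close> replays the
    machine on them and recovers both the state and the position.\<close>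
  define M where "M = foldl (\<lambda>(st, xs) V. (nx st xs V, xs @ [mv st xs V])) (st0, x)"
  define \<alpha> where "\<alpha> Vs = last (snd (M Vs))" for Vs
  have M0: "M [] = (st0, x)" by (simp add: M_def)
  have MS: "M (Vs @ [V]) = (nx (fst (M Vs)) (snd (M Vs)) V, snd (M Vs) @ [mv (fst (M Vs)) (snd (M Vs)) V])" for Vs V
    by (simp add: M_def split: prod.splits)
  have main: "snd (M (map Vs [0..<k])) = x @ map (II_response \<alpha> Vs) [0..<k] \<and>
      P (fst (M (map Vs [0..<k]))) (snd (M (map Vs [0..<k])))" if V: "I_legal_G Y Vs" for Vs k
  proof (induction k)
    case 0
    then show ?case using init M0 by simp
  next
    case (Suc k)
    have "II_response \<alpha> Vs k = last (snd (M (map Vs [0..<k] @ [Vs k])))"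
      by (simp add: II_response_def \<alpha>_def)
    moreover have "Vs k \<in> Einf" "Vs k \<preceq> Y" using V by (auto simp: I_legal_G_def)
    moreover have "P (fst (M (map Vs [0..<k]))) (x @ map (II_response \<alpha> Vs) [0..<k])"
      using Suc by metis
    ultimately show ?case
      using Suc mvnx[of "fst (M (map Vs [0..<k]))" "x @ map (II_response \<alpha> Vs) [0..<k]" "Vs k"]
      by (auto simp: MS)
  qed
  have pos: "snd (M (map Vs [0..<k])) = x @ map (II_response \<alpha> Vs) [0..<k]"
    and inv: "P (fst (M (map Vs [0..<k]))) (x @ map (II_response \<alpha> Vs) [0..<k])"
    if "I_legal_G Y Vs" for Vs k
    using main[OF that, of k] by metis+
  have resp: "II_response \<alpha> Vs k = mv (fst (M (map Vs [0..<k]))) (snd (M (map Vs [0..<k]))) (Vs k)" for Vs k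
    by (simp add: II_response_def \<alpha>_def MS)
  have move: "II_response \<alpha> Vs k \<in> span_seq (Vs k) \<and> after (x @ map (II_response \<alpha> Vs) [0..<k]) (II_response \<alpha> Vs k)
      \<and> R (fst (M (map Vs [0..<k]))) (II_response \<alpha> Vs k) (fst (M (map Vs [0..<Suc k])))"
    if V: "I_legal_G Y Vs" for Vs k
  proof -
    have "Vs k \<in> Einf" "Vs k \<preceq> Y" using V by (auto simp: I_legal_G_def)
    then show ?thesis
      using mvnx[OF inv[OF V, of k]] pos[OF V, of k] by (simp add: resp MS)
  qed
  show thesis
  proof (rule that)
    show "strategy_II_G x Y \<alpha>"
      unfolding strategy_II_G_def using move by blast
    fix z assume "z \<in> G_outcomes x Y \<alpha>"
    then obtain Vs where V: "I_legal_G Y Vs" "z = cat_seq x (II_response \<alpha> Vs)"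
      by (auto simp: G_outcomes_def)
    let ?S = "\<lambda>k. fst (M (map Vs [0..<k]))"
    have "?S 0 = st0" by (simp add: M0)
    moreover have "II_response \<alpha> Vs k \<in> span_seq Y" for k
      using move[OF V(1), of k] V(1) by (auto simp: I_legal_G_def below_def)
    moreover have "P (?S k) (x @ map (II_response \<alpha> Vs) [0..<k])" for k
      by (rule inv[OF V(1)])
    moreover have "R (?S k) (II_response \<alpha> Vs k) (?S (Suc k))" for k
      using move[OF V(1), of k] by blast
    ultimately show "\<exists>ys S. z = cat_seq x ys \<and> S 0 = st0 \<and>
      (\<forall>k. ys k \<in> span_seq Y \<and> P (S k) (x @ map ys [0..<k]) \<and> R (S k) (ys k) (S (Suc k)))"
      using V(2) by (intro exI[of _ "II_response \<alpha> Vs"] exI[of _ ?S]) blast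
  qed
qed

section \<open>Members of the filter, forcing conditions and fusion\<close>

locale strategic_filter =
  fixes U :: "(nat \<Rightarrow> 'f::{field,countable} vec) set"
  assumes strategic_U: "strategic U" and p_plus: "p_plus_filter U"
begin

lemma U_Einf: "Y \<in> U \<Longrightarrow> Y \<in> Einf"
  using p_plus by (auto simp: p_plus_filter_def is_filter_def family_def)

lemma U_upward: "Y \<in> U \<Longrightarrow> X \<in> Einf \<Longrightarrow> Y \<preceq>\<^sup>* X \<Longrightarrow> X \<in> U"
  using p_plus unfolding p_plus_filter_def is_filter_def family_def by blast

lemma U_tail: "Y \<in> U \<Longrightarrow> tail m Y \<in> U"
  by (rule U_upward[OF _ tail_Einf star_tail]) (auto dest: U_Einf)

lemma U_lower:
  assumes "X \<in> U" "Y \<in> U"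
  obtains Z where "Z \<in> U" "Z \<preceq> X" "Z \<preceq> Y"
  using p_plus assms unfolding p_plus_filter_def is_filter_def by blast

lemma U_star_trans: "X \<preceq>\<^sup>* Y \<Longrightarrow> Y \<preceq>\<^sup>* Z \<Longrightarrow> X \<in> U \<Longrightarrow> Y \<in> U \<Longrightarrow> X \<preceq>\<^sup>* Z"
  by (rule below_star_trans) (auto intro: U_Einf)

lemma star_refine:
  assumes "Y \<in> U" "Y \<preceq>\<^sup>* X"
  obtains Y' where "Y' \<in> U" "Y' \<preceq> X" "Y' \<preceq> Y" "Y \<preceq>\<^sup>* Y'"
  using assms U_tail tail_below star_tail unfolding below_star_def by metis

text \<open>Fullness is applied to the complement of \<open>B\<close>. If its hypothesis fails, some
  \<open>Y'\<close> in \<open>U\<close> below \<open>Y\<close> has no block sequence below it whose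
  span avoids \<open>B\<close>.\<close>

lemma full_dichotomy:
  assumes "Y \<in> U"
  obtains Y' where "Y' \<in> U" "Y' \<preceq> Y" "span_seq Y' \<inter> B = {}"
  | Y' where "Y' \<in> U" "Y' \<preceq> Y" "\<And>V. V \<in> Einf \<Longrightarrow> V \<preceq> Y' \<Longrightarrow> span_seq V \<inter> B \<noteq> {}"
proof (cases "\<forall>Y'\<in>U \<restriction> Y. \<exists>Z\<in>Einf. Z \<preceq> Y' \<and> span_seq Z \<subseteq> - B")
  case True
  then have "\<exists>Z\<in>U \<restriction> Y. span_seq Z \<subseteq> - B"
    using p_plus assms unfolding p_plus_filter_def full_def by blast
  then show thesis using that(1) by (auto simp: restr_def)
next
  case False
  then show thesis using that(2) by (fastforce simp: restr_def)
qed

text \<open>The order on conditions. Almost inclusion is used in the first coordinate because the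
  bound provided by \<open>(p)\<close> is only almost below the sequence.\<close>

definition extends where
  "extends Y' q' Y q \<longleftrightarrow> Y' \<in> U \<and> perfect_tree q' \<and> Y' \<preceq>\<^sup>* Y \<and> q' \<subseteq> q"

definition cond where
  "cond Y q \<longleftrightarrow> Y \<in> U \<and> perfect_tree q"

lemma extends_cond: "extends Y' q' Y q \<Longrightarrow> cond Y' q'"
  by (simp add: extends_def cond_def)

lemma extends_refl: "cond Y q \<Longrightarrow> extends Y q Y q"
  by (simp add: extends_def cond_def below_imp_star below_def)

lemma extends_trans: "extends Y'' q'' Y' q' \<Longrightarrow> extends Y' q' Y q \<Longrightarrow> extends Y'' q'' Y q"
  unfolding extends_def using U_star_trans by blast

lemma extends_subtree: "extends Y' q' Y q \<Longrightarrow> t \<in> q' \<Longrightarrow> extends Y' (subtree q' t) Y (subtree q t)"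
  by (simp add: extends_def perfect_subtree subtree_mono)

lemma cond_subtree: "cond Y q \<Longrightarrow> t \<in> q \<Longrightarrow> extends Y (subtree q t) Y q"
  using subtree_subset[of q t]
  by (auto simp: extends_def cond_def perfect_subtree below_imp_star below_def)

lemma fusion:
  fixes \<Phi> :: "'i \<Rightarrow> (nat \<Rightarrow> 'f vec) \<Rightarrow> bool list set \<Rightarrow> bool"
  assumes c0: "cond Y0 q0" and I: "countable I"
    and dense: "\<And>i Y q. i \<in> I \<Longrightarrow> extends Y q Y0 q0 \<Longrightarrow> \<exists>Y' q'. extends Y' q' Y q \<and> \<Phi> i Y' q'"
    and hered: "\<And>i Y q Y' q'. i \<in> I \<Longrightarrow> \<Phi> i Y q \<Longrightarrow> cond Y q \<Longrightarrow> extends Y' q' Y q \<Longrightarrow> \<Phi> i Y' q'"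
  obtains Y q N where "extends Y q Y0 q0"
    "\<And>i t. i \<in> I \<Longrightarrow> t \<in> q \<Longrightarrow> N i \<le> length t \<Longrightarrow> \<Phi> i Y (subtree q t)"
proof (cases "I = {}")
  case True
  then show thesis using that[of Y0 q0] extends_refl[OF c0] by simp
next
  case False
  define e where "e = from_nat_into I"
  have eI: "e k \<in> I" for k unfolding e_def using False by (rule from_nat_into)
  define ok where "ok = (\<lambda>(Y, q, n::nat). extends Y q Y0 q0)"
  define nxt where "nxt = (\<lambda>k (Y, q, n) (Y', q', n'). Y' \<preceq> Y \<and> q' \<subseteq> q \<and>
     (\<forall>t\<in>q. length t = n \<longrightarrow> t \<in> q' \<and> \<Phi> (e k) Y' (subtree q' t) \<and>
        (\<exists>u\<in>q'. \<exists>v\<in>q'. length u = n' \<and> length v = n' \<and> prefix t u \<and> prefix t v \<and> u \<noteq> v)) \<and> n \<le> n')"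
  have step: "\<exists>C'. ok C' \<and> nxt k C C'" if "ok C" for k C
  proof -
    obtain Y q n where C: "C = (Y, q, n)" by (cases C)
    have Yq: "extends Y q Y0 q0" using that by (simp add: C ok_def)
    then have YU: "Y \<in> U" and q: "perfect_tree q" by (auto simp: extends_def)
    define L where "L = {t \<in> q. length t = n}"
    have finL: "finite L"
      unfolding L_def by (rule finite_subset[OF _ finite_lists_length_eq[of "UNIV::bool set" n]]) auto
    \<comment> \<open>The nodes of the level are treated one after the other. \<open>Y'\<close>
      shrinks each time, and heredity keeps what was achieved at the earlier nodes.\<close>
    have amalg: "\<exists>Y' p. Y' \<in> U \<and> Y' \<preceq> Y \<and> (\<forall>t\<in>F. perfect_tree (p t) \<and> p t \<subseteq> subtree q t \<and> \<Phi> (e k) Y' (p t))"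
      if "finite F" "F \<subseteq> L" for F
      using that
    proof (induction F rule: finite_induct)
      case empty
      then show ?case using YU by (auto simp: below_def)
    next
      case (insert t F)
      then obtain Y1 p where Y1: "Y1 \<in> U" "Y1 \<preceq> Y"
        "\<forall>t\<in>F. perfect_tree (p t) \<and> p t \<subseteq> subtree q t \<and> \<Phi> (e k) Y1 (p t)" by auto
      have t: "t \<in> q" using insert by (auto simp: L_def)
      have "extends Y1 (subtree q t) Y q"
        using Y1 perfect_subtree[OF q t] subtree_subset by (auto simp: extends_def below_imp_star)
      then obtain Y2 p2 where Y2: "extends Y2 p2 Y1 (subtree q t)" "\<Phi> (e k) Y2 p2"
        using dense[OF eI] Yq extends_trans by blast
      \<comment> \<open>\<open>(p)\<close> asks for a sequence decreasing under
        \<open>\<preceq>\<close>, so the almost inclusion \<open>Y2 \<preceq>\<^sup>* Y1\<close> is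
        sharpened here.\<close>
      then obtain Y3 where Y3: "Y3 \<in> U" "Y3 \<preceq> Y1" "Y3 \<preceq> Y2"
        using star_refine unfolding extends_def by metis
      have "extends Y3 p2 Y2 p2" using Y3 Y2 by (auto simp: extends_def below_imp_star)
      then have "\<Phi> (e k) Y3 p2" using hered[OF eI Y2(2)] Y2(1) extends_cond by blast
      moreover have "\<Phi> (e k) Y3 (p s)" if "s \<in> F" for s
      proof -
        have "extends Y3 (p s) Y1 (p s)" using Y3 Y1 that by (auto simp: extends_def below_imp_star)
        then show ?thesis using hered[OF eI] Y1 that unfolding cond_def by blast
      qed
      ultimately have "\<forall>s\<in>insert t F. perfect_tree ((p(t:=p2)) s) \<and> (p(t:=p2)) s \<subseteq> subtree q s \<and> \<Phi> (e k) Y3 ((p(t:=p2)) s)"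
        using Y1 Y2 insert.hyps by (auto simp: extends_def)
      then show ?case using Y3 Y1 below_trans by blast
    qed
    obtain Y' p where Y': "Y' \<in> U" "Y' \<preceq> Y" and
      p: "\<And>t. t \<in> L \<Longrightarrow> perfect_tree (p t) \<and> p t \<subseteq> subtree q t \<and> \<Phi> (e k) Y' (p t)"
      using amalg[OF finL order_refl] by metis
    have stem: "t \<in> p t" if "t \<in> L" for t using stem_in_subtree p[OF that] by blast
    define q' where "q' = (\<Union>t\<in>L. p t)"
    have q'q: "q' \<subseteq> q" using p subtree_subset by (fastforce simp: q'_def)
    have "L \<noteq> {}" using perfect_extend[OF q perfect_Nil[OF q], of n] by (force simp: L_def)
    have pq': "perfect_tree q'"
    proof -
      have "q' \<noteq> {}" using stem \<open>L \<noteq> {}\<close> by (auto simp: q'_def)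
      moreover have "s \<in> q'" if "s @ w \<in> q'" for s w
      proof -
        from that obtain t where "t \<in> L" "s @ w \<in> p t" unfolding q'_def by blast
        then show ?thesis using perfect_prefix[of "p t" "s @ w" s] p[of t] by (auto simp: q'_def)
      qed
      moreover have "\<exists>w. s @ w @ [False] \<in> q' \<and> s @ w @ [True] \<in> q'" if "s \<in> q'" for s
      proof -
        from that obtain t where t: "t \<in> L" "s \<in> p t" unfolding q'_def by blast
        then obtain w where "s @ w @ [False] \<in> p t" "s @ w @ [True] \<in> p t"
          using perfect_split p[of t] by metis
        then show ?thesis using t(1) unfolding q'_def by blast
      qed
      ultimately show ?thesis unfolding perfect_tree_def by blast
    qed
    \<comment> \<open>Distinct nodes of \<open>L\<close> have equal length and so are incomparable;
      above \<open>t\<close> the union \<open>q'\<close> therefore consists of \<open>p t\<close>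
      alone.\<close>
    have sub: "subtree q' t = p t" if t: "t \<in> L" for t
    proof
      show "p t \<subseteq> subtree q' t" using p[OF t] t by (auto simp: q'_def subtree_def)
      show "subtree q' t \<subseteq> p t"
      proof
        fix u assume u: "u \<in> subtree q' t"
        then obtain s where s: "s \<in> L" "u \<in> p s" by (auto simp: subtree_def q'_def)
        show "u \<in> p t"
        proof (cases "prefix u t")
          case True
          then show ?thesis using perfect_prefix p[OF t] stem[OF t] by blast
        next
          case False
          then have tu: "prefix t u" using u by (auto simp: subtree_def)
          moreover have "length t < length u"
            using tu False prefix_length_le[OF tu] prefix_length_eq[of t u] by (cases "length t = length u") auto
          moreover have "prefix u s \<or> prefix s u" using p[OF s(1)] s(2) by (auto simp: subtree_def)
          ultimately have "prefix s u"
            using t s(1) prefix_length_le[of u s] by (auto simp: L_def)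
          then have "s = t" using tu t s(1) prefix_length_prefix[of s u t] prefix_length_eq[of s t] by (auto simp: L_def)
          then show ?thesis using s by simp
        qed
      qed
    qed
    have "\<exists>m. \<exists>u\<in>q'. \<exists>v\<in>q'. length u = m \<and> length v = m \<and> prefix t u \<and> prefix t v \<and> u \<noteq> v" if "t \<in> L" for t
    proof -
      have "t \<in> q'" using stem[OF that] that by (auto simp: q'_def)
      then obtain w where "t @ w @ [False] \<in> q'" "t @ w @ [True] \<in> q'" using perfect_split[OF pq'] by metis
      then show ?thesis by (intro exI[of _ "length (t @ w @ [False])"] bexI[of _ "t @ w @ [False]"] bexI[of _ "t @ w @ [True]"]) auto
    qed
    then obtain m where m: "\<And>t. t \<in> L \<Longrightarrow> \<exists>u\<in>q'. \<exists>v\<in>q'. length u = m t \<and> length v = m t \<and> prefix t u \<and> prefix t v \<and> u \<noteq> v"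
      by metis
    define n' where "n' = Max (insert n (m ` L))"
    have n': "n \<le> n'" "\<And>t. t \<in> L \<Longrightarrow> m t \<le> n'" using finL by (auto simp: n'_def)
    have "\<exists>u\<in>q'. \<exists>v\<in>q'. length u = n' \<and> length v = n' \<and> prefix t u \<and> prefix t v \<and> u \<noteq> v" if t: "t \<in> L" for t
    proof -
      obtain u v where uv: "u \<in> q'" "v \<in> q'" "length u = m t" "length v = m t" "prefix t u" "prefix t v" "u \<noteq> v"
        using m[OF t] by blast
      obtain u' where u': "u' \<in> q'" "prefix u u'" "length u' = n'"
        using perfect_extend[OF pq' uv(1)] n'(2)[OF t] uv(3) by metis
      obtain v' where v': "v' \<in> q'" "prefix v v'" "length v' = n'"
        using perfect_extend[OF pq' uv(2)] n'(2)[OF t] uv(4) by metis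
      have "u' \<noteq> v'" using uv u' v' prefix_length_prefix[of u u' v] prefix_length_eq[of u v] by auto
      then show ?thesis using u' v' uv prefix_order.trans by blast
    qed
    then have "nxt k (Y, q, n) (Y', q', n')"
      unfolding nxt_def using Y' q'q n' stem sub p by (auto simp: L_def q'_def)
    moreover have "ok (Y', q', n')"
    proof -
      have "extends Y' q' Y q" using Y' pq' q'q by (auto simp: extends_def below_imp_star)
      then show ?thesis using Yq extends_trans by (simp add: ok_def)
    qed
    ultimately show ?thesis using C by blast
  qed
  have "\<exists>F. \<forall>k. ok (F k) \<and> nxt k (F k) (F (Suc k))"
  proof (rule dependent_nat_choice)
    show "\<exists>C. ok C" using extends_refl[OF c0] by (intro exI[of _ "(Y0, q0, 0)"]) (simp add: ok_def)
  qed (use step in blast)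
  then obtain F where F: "\<And>k. ok (F k)" "\<And>k. nxt k (F k) (F (Suc k))" by blast
  define Ys where "Ys k = fst (F k)" for k
  define qs where "qs k = fst (snd (F k))" for k
  define ns where "ns k = snd (snd (F k))" for k
  have Feq: "F k = (Ys k, qs k, ns k)" for k by (simp add: Ys_def qs_def ns_def)
  have ext: "extends (Ys k) (qs k) Y0 q0" for k using F(1)[of k] by (simp add: Feq ok_def)
  have dec: "Ys (Suc k) \<preceq> Ys k" "qs (Suc k) \<subseteq> qs k" "ns k \<le> ns (Suc k)" for k
    using F(2)[of k] by (simp_all add: Feq nxt_def)
  have node: "t \<in> qs (Suc k) \<and> \<Phi> (e k) (Ys (Suc k)) (subtree (qs (Suc k)) t) \<and>
      (\<exists>u\<in>qs (Suc k). \<exists>v\<in>qs (Suc k). length u = ns (Suc k) \<and> length v = ns (Suc k) \<and>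
         prefix t u \<and> prefix t v \<and> u \<noteq> v)"
    if "t \<in> qs k" "length t = ns k" for k t
    using F(2)[of k] that by (simp add: Feq nxt_def)
  have antimono: "qs l \<subseteq> qs k" if "k \<le> l" for k l
    using that dec(2) by (rule lift_Suc_antimono_le[rotated]) 
  have YsU: "Ys k \<in> U" for k using ext by (auto simp: extends_def)
  obtain Y where Y: "Y \<in> U" "\<And>k. Y \<preceq>\<^sup>* Ys k"
    using p_plus YsU dec(1) unfolding p_plus_filter_def has_p_def by metis
  define S where "S k = {t \<in> qs k. length t = ns k}" for k
  \<comment> \<open>The limit tree: every frozen node extends to nodes of all later frozen levels,
    which also places \<open>q\<close> inside each \<open>qs k\<close>.\<close>
  define q where "q = {u. \<exists>n. \<exists>t\<in>S n. prefix u t}"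
  have "finite (S k)" for k
    unfolding S_def by (rule finite_subset[OF _ finite_lists_length_eq[of "UNIV::bool set" "ns k"]]) auto
  moreover have "S 0 \<noteq> {}"
  proof -
    have "perfect_tree (qs 0)" using ext by (auto simp: extends_def)
    then show ?thesis using perfect_extend[OF _ perfect_Nil, of "qs 0" "ns 0"] by (force simp: S_def)
  qed
  moreover have "\<exists>s\<in>S k. prefix s t" if "t \<in> S (Suc k)" for k t
  proof -
    have "take (ns k) t \<in> qs (Suc k)"
      using that ext[of "Suc k"] perfect_prefix take_is_prefix unfolding S_def extends_def by blast
    then show ?thesis using dec[of k] that
      by (intro bexI[of _ "take (ns k) t"]) (auto simp: S_def take_is_prefix)
  qed
  moreover have "\<exists>t\<in>S (Suc k). \<exists>u\<in>S (Suc k). prefix s t \<and> prefix s u \<and> \<not> prefix t u \<and> \<not> prefix u t"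
    if s: "s \<in> S k" for k s
  proof -
    obtain u v where "u \<in> S (Suc k)" "v \<in> S (Suc k)" "prefix s u" "prefix s v" "u \<noteq> v"
      using node[of s k] s unfolding S_def by blast
    moreover from this have "\<not> prefix u v" "\<not> prefix v u"
      using prefix_length_eq[of u v] prefix_length_eq[of v u] by (auto simp: S_def)
    ultimately show ?thesis by blast
  qed
  ultimately have pq: "perfect_tree q" unfolding q_def by (rule perfect_scheme(1))
  have q_sub: "q \<subseteq> qs k" for k
  proof
    fix u assume "u \<in> q"
    then obtain n t where t: "t \<in> S n" "prefix u t" by (auto simp: q_def)
    have "\<exists>t'\<in>S (n + k). prefix t t'"
    proof (induction k)
      case 0
      then show ?case using t by auto
    next
      case (Suc k)
      then obtain t' where t': "t' \<in> S (n + k)" "prefix t t'" by blast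
      then obtain u where "u \<in> S (Suc (n + k))" "prefix t' u" using node[of t' "n + k"] by (auto simp: S_def)
      then show ?case using t' prefix_order.trans by auto
    qed
    then obtain t' where "t' \<in> qs (n + k)" "prefix u t'"
      using t prefix_order.trans by (auto simp: S_def)
    moreover have "qs (n + k) \<subseteq> qs k" by (rule antimono) simp
    ultimately show "u \<in> qs k" using ext[of k] perfect_prefix unfolding extends_def by blast
  qed
  \<comment> \<open>The level frozen when \<open>i\<close> was treated, since
    \<open>to_nat_on I i\<close> is a stage \<open>k\<close> with \<open>e k = i\<close>.\<close>
  define N where "N i = ns (to_nat_on I i)" for i
  show thesis
  proof (rule that)
    show "extends Y q Y0 q0"
      using ext[of 0] Y pq q_sub[of 0] U_star_trans YsU unfolding extends_def by blast
    fix i t assume it: "i \<in> I" "t \<in> q" "N i \<le> length t"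
    define k where "k = to_nat_on I i"
    have ek: "e k = i" using it(1) I by (simp add: e_def k_def)
    let ?s = "take (ns k) t"
    have len: "length ?s = ns k" using it by (simp add: N_def k_def)
    have s: "?s \<in> qs k" using perfect_prefix[OF pq it(2) take_is_prefix] q_sub by blast
    then have P: "\<Phi> i (Ys (Suc k)) (subtree (qs (Suc k)) ?s)" and sk: "?s \<in> qs (Suc k)"
      using node[OF s len] ek by auto
    have "cond (Ys (Suc k)) (subtree (qs (Suc k)) ?s)"
      using perfect_subtree[OF _ sk] ext[of "Suc k"] by (auto simp: cond_def extends_def)
    moreover have "extends Y (subtree q t) (Ys (Suc k)) (subtree (qs (Suc k)) ?s)"
      unfolding extends_def using Y perfect_subtree[OF pq it(2)] subtree_mono[OF q_sub take_is_prefix] by blast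
    ultimately show "\<Phi> i Y (subtree q t)" using hered[OF it(1) P] by blast
  qed
qed

text \<open>Fusion started from the full binary tree, for predicates that ignore the tree; any
  sufficiently long node of the resulting tree then yields the conclusion.\<close>

lemma diagonalize:
  assumes Y0: "Y0 \<in> U" and I: "countable I"
    and dense: "\<And>i Y. i \<in> I \<Longrightarrow> Y \<in> U \<Longrightarrow> Y \<preceq>\<^sup>* Y0 \<Longrightarrow> \<exists>Y'\<in>U. Y' \<preceq>\<^sup>* Y \<and> \<Psi> i Y'"
    and hered: "\<And>i Y Y'. i \<in> I \<Longrightarrow> \<Psi> i Y \<Longrightarrow> Y \<in> U \<Longrightarrow> Y' \<in> U \<Longrightarrow> Y' \<preceq>\<^sup>* Y \<Longrightarrow> \<Psi> i Y'"
  obtains Y where "Y \<in> U" "Y \<preceq>\<^sup>* Y0" "\<And>i. i \<in> I \<Longrightarrow> \<Psi> i Y"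
proof -
  have c0: "cond Y0 UNIV" using Y0 by (simp add: cond_def perfect_tree_def)
  obtain Y q N where ext: "extends Y q Y0 UNIV"
    and N: "\<And>i t. i \<in> I \<Longrightarrow> t \<in> q \<Longrightarrow> N i \<le> length t \<Longrightarrow> \<Psi> i Y"
  proof (rule fusion[OF c0 I, where \<Phi>="\<lambda>i Y q. \<Psi> i Y"])
    fix i Y q assume "i \<in> I" "extends Y q Y0 UNIV"
    then show "\<exists>Y' q'. extends Y' q' Y q \<and> \<Psi> i Y'"
      using dense unfolding extends_def by blast
  next
    fix i Y q Y' q' assume "i \<in> I" "\<Psi> i Y" "cond Y q" "extends Y' q' Y q"
    then show "\<Psi> i Y'" using hered unfolding extends_def cond_def by blast
  qed metis
  have q: "perfect_tree q" using ext by (simp add: extends_def)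
  have "\<Psi> i Y" if i: "i \<in> I" for i
  proof -
    obtain t where "t \<in> q" "length t = N i"
      by (rule perfect_extend[OF q perfect_Nil[OF q], of "N i"]) auto
    then show ?thesis using N[OF i] by simp
  qed
  then show thesis using that ext by (auto simp: extends_def)
qed

text \<open>A member of \<open>U\<close> can be chosen vector by vector as long as no member of \<open>U\<close> blocks the next
  step. Fullness turns ``every member of \<open>U\<close> contains a next vector'' into ``every block sequence
  below some member does'', which is a strategy for II.\<close>

lemma generic_run:
  fixes nxt :: "'s \<Rightarrow> 'f vec \<Rightarrow> 's \<Rightarrow> bool"
  assumes Y0: "Y0 \<in> U" and cG: "countable Good" and st0: "st0 \<in> Good"
    and step: "\<And>st Y. st \<in> Good \<Longrightarrow> Y \<in> U \<Longrightarrow> Y \<preceq>\<^sup>* Y0 \<Longrightarrow>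
      \<exists>y\<in>span_seq Y. nzE y \<and> (\<exists>st'\<in>Good. nxt st y st')"
  obtains Z S where "Z \<in> U" "Z \<preceq>\<^sup>* Y0" "S 0 = st0" "\<And>k. S k \<in> Good"
    "\<And>k. nxt (S k) (Z k) (S (Suc k))"
proof -
  define B where "B st = {y. nzE y \<and> (\<exists>st'\<in>Good. nxt st y st')}" for st
  obtain Y where Y: "Y \<in> U" "Y \<preceq>\<^sup>* Y0"
    "\<And>st. st \<in> Good \<Longrightarrow> \<forall>V\<in>Einf. V \<preceq>\<^sup>* Y \<longrightarrow> span_seq V \<inter> B st \<noteq> {}"
  proof (rule diagonalize[OF Y0 cG, where \<Psi>="\<lambda>st Y. \<forall>V\<in>Einf. V \<preceq>\<^sup>* Y \<longrightarrow> span_seq V \<inter> B st \<noteq> {}"])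
    fix st Y assume st: "st \<in> Good" and Y: "Y \<in> U" "Y \<preceq>\<^sup>* Y0"
    show "\<exists>Y'\<in>U. Y' \<preceq>\<^sup>* Y \<and> (\<forall>V\<in>Einf. V \<preceq>\<^sup>* Y' \<longrightarrow> span_seq V \<inter> B st \<noteq> {})"
    \<comment> \<open>The first alternative contradicts \<open>step\<close>; the second is extended
      from \<open>\<preceq>\<close> to almost inclusion by passing to a tail.\<close>
    proof (rule full_dichotomy[OF Y(1), of "B st"])
      fix Y' assume Y': "Y' \<in> U" "Y' \<preceq> Y" "span_seq Y' \<inter> B st = {}"
      then have "Y' \<preceq>\<^sup>* Y0" using Y U_star_trans below_imp_star by blast
      then obtain y where "y \<in> span_seq Y'" "y \<in> B st"
        using step[OF st Y'(1)] unfolding B_def by blast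
      then show ?thesis using Y'(3) by blast
    next
      fix Y' assume Y': "Y' \<in> U" "Y' \<preceq> Y"
        "\<And>V. V \<in> Einf \<Longrightarrow> V \<preceq> Y' \<Longrightarrow> span_seq V \<inter> B st \<noteq> {}"
      have "span_seq V \<inter> B st \<noteq> {}" if V: "V \<in> Einf" "V \<preceq>\<^sup>* Y'" for V
      proof -
        obtain m where "tail m V \<preceq> Y'" using V(2) by (auto simp: below_star_def)
        then have "span_seq (tail m V) \<inter> B st \<noteq> {}" using Y'(3) tail_Einf[OF V(1)] by blast
        then show ?thesis using tail_below[where m=m and Y=V] by (auto simp: below_def)
      qed
      then show ?thesis using Y' below_imp_star by blast
    qed
  next
    fix st Y Y' assume "\<forall>V\<in>Einf. V \<preceq>\<^sup>* Y \<longrightarrow> span_seq V \<inter> B st \<noteq> {}" "Y \<in> U" "Y' \<in> U" "Y' \<preceq>\<^sup>* Y"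
    then show "\<forall>V\<in>Einf. V \<preceq>\<^sup>* Y' \<longrightarrow> span_seq V \<inter> B st \<noteq> {}"
      using below_star_trans U_Einf by blast
  qed blast
  obtain \<alpha> where \<alpha>: "strategy_II_G [] Y \<alpha>" "\<And>z. z \<in> G_outcomes [] Y \<alpha> \<Longrightarrow>
      \<exists>ys S. z = cat_seq [] ys \<and> S 0 = st0 \<and>
      (\<forall>k. ys k \<in> span_seq Y \<and> S k \<in> Good \<and> nxt (S k) (ys k) (S (Suc k)))"
  proof (rule strategy_from_states[of "\<lambda>st xs. st \<in> Good" st0 "[]" Y nxt])
    show "st0 \<in> Good" by (rule st0)
    fix st and xs :: "'f vec list" and V
    assume V: "st \<in> Good" "V \<in> Einf" "V \<preceq> Y"
    \<comment> \<open>Answering from this tail of \<open>V\<close> puts the move behind the last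
      vector of \<open>xs\<close>. For empty \<open>xs\<close> the value of \<open>m\<close> is
      arbitrary and harmless.\<close>
    define m where "m = Suc (Max (supp (last xs)))"
    have "tail m V \<preceq>\<^sup>* Y" using below_trans[OF tail_below V(3)] by (rule below_imp_star)
    then obtain y where y: "y \<in> span_seq (tail m V)" "y \<in> B st"
      using Y(3)[OF V(1)] tail_Einf[OF V(2)] by blast
    then have "after xs y"
      using tail_span_Min[OF V(2) y(1)] by (auto simp: after_def B_def m_def)
    moreover have "y \<in> span_seq V" using y(1) tail_below[where m=m and Y=V] by (auto simp: below_def)
    ultimately show "\<exists>y\<in>span_seq V. after xs y \<and> (\<exists>st'. nxt st y st' \<and> st' \<in> Good)"
      using y(2) by (auto simp: B_def)
  qed blast
  have "G_outcomes [] Y \<alpha> \<inter> U \<noteq> {}"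
    using strategic_U Y(1) \<alpha>(1) by (simp add: strategic_def)
  then obtain Z where Z: "Z \<in> U" "Z \<in> G_outcomes [] Y \<alpha>" by blast
  then obtain S where S: "S 0 = st0" "\<And>k. Z k \<in> span_seq Y \<and> S k \<in> Good \<and> nxt (S k) (Z k) (S (Suc k))"
    using \<alpha>(2) by (fastforce simp: cat_seq_def)
  have "Z \<preceq> Y" unfolding below_def by (rule span_seq_subset) (use S in blast)
  then have "Z \<preceq>\<^sup>* Y0" using Y Z U_star_trans below_imp_star by blast
  then show thesis using that Z(1) S by blast
qed

text \<open>Call \<open>a\<close> leaving if below some member of \<open>U\<close> every block
  sequence contains a continuation of \<open>a\<close> outside \<open>T\<close>. If \<open>a\<close>
  is not leaving, every member of \<open>U\<close> almost below \<open>Y0\<close> offers a next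
  vector preserving this: otherwise diagonalizing over its vectors would make \<open>a\<close>
  leaving. So if \<open>[]\<close> is not leaving, a generic run stays non-leaving, hence in
  \<open>T\<close>, because sequences outside \<open>T\<close> leave by the empty
  continuation.\<close>

lemma leave_or_run:
  fixes T :: "'f vec list set"
  assumes Y0: "Y0 \<in> U"
  obtains Y where "Y \<in> U" "Y \<preceq>\<^sup>* Y0" "\<And>V. V \<in> Einf \<Longrightarrow> V \<preceq>\<^sup>* Y \<Longrightarrow> \<exists>ys. set ys \<subseteq> span_seq V \<and> ys \<notin> T"
  | Z where "Z \<in> U" "Z \<preceq>\<^sup>* Y0" "\<And>k. map Z [0..<k] \<in> T"
proof -
  define L where "L a Y \<longleftrightarrow> (\<forall>V\<in>Einf. V \<preceq>\<^sup>* Y \<longrightarrow> (\<exists>ys. set ys \<subseteq> span_seq V \<and> a @ ys \<notin> T))" for a Y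
  define leaves where "leaves a \<longleftrightarrow> (\<exists>Y\<in>U. Y \<preceq>\<^sup>* Y0 \<and> L a Y)" for a
  have L_mono: "L a Y \<Longrightarrow> Y \<in> U \<Longrightarrow> Y' \<in> U \<Longrightarrow> Y' \<preceq>\<^sup>* Y \<Longrightarrow> L a Y'" for a Y Y'
    unfolding L_def using below_star_trans U_Einf by blast
  have step: "\<exists>y\<in>span_seq Y. nzE y \<and> \<not> leaves (a @ [y])"
    if na: "\<not> leaves a" and Y: "Y \<in> U" "Y \<preceq>\<^sup>* Y0" for a Y
  proof (rule ccontr)
    assume "\<not> ?thesis"
    then have lv: "leaves (a @ [y])" if "y \<in> span_seq Y" "nzE y" for y using that by blast
    define I where "I = {y \<in> span_seq Y. nzE y}"
    have cI: "countable I" unfolding I_def by (rule countable_subset[OF _ countable_nzE]) blast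
    obtain Y' where Y': "Y' \<in> U" "Y' \<preceq>\<^sup>* Y" "\<And>y. y \<in> I \<Longrightarrow> L (a @ [y]) Y'"
    proof (rule diagonalize[OF Y(1) cI, where \<Psi>="\<lambda>y Y'. L (a @ [y]) Y'"])
      fix y Y1 assume "y \<in> I" and Y1: "Y1 \<in> U" "Y1 \<preceq>\<^sup>* Y"
      then obtain Y2 where Y2: "Y2 \<in> U" "L (a @ [y]) Y2" using lv by (auto simp: I_def leaves_def)
      obtain Y3 where "Y3 \<in> U" "Y3 \<preceq> Y1" "Y3 \<preceq> Y2" using U_lower[OF Y1(1) Y2(1)] .
      then show "\<exists>Y'\<in>U. Y' \<preceq>\<^sup>* Y1 \<and> L (a @ [y]) Y'"
        using L_mono[OF Y2(2,1)] below_imp_star by blast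
    qed (use L_mono in blast)+
    have "L a Y'"
      unfolding L_def
    proof (intro ballI impI)
      fix V assume V: "V \<in> Einf" "V \<preceq>\<^sup>* Y'"
      then have "V \<preceq>\<^sup>* Y" using Y'(1,2) below_star_trans U_Einf by blast
      then obtain m where "tail m V \<preceq> Y" by (auto simp: below_star_def)
      then have "V m \<in> span_seq Y" using in_span_seq[of "tail m V" 0] by (auto simp: below_def)
      \<comment> \<open>The next vector is taken from \<open>V\<close> itself, so that
        \<open>V m # ys\<close> again lies in the span of \<open>V\<close>.\<close>
      then have "V m \<in> I" using Einf_nz[OF V(1)] by (simp add: I_def)
      then obtain ys where "set ys \<subseteq> span_seq V" "(a @ [V m]) @ ys \<notin> T"
        using Y'(3) V unfolding L_def by blast
      then show "\<exists>ys. set ys \<subseteq> span_seq V \<and> a @ ys \<notin> T"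
        using in_span_seq[of V m] by (intro exI[of _ "V m # ys"]) auto
    qed
    then show False using na Y' Y U_star_trans unfolding leaves_def by blast
  qed
  show thesis
  proof (cases "leaves []")
    case True
    then show thesis using that(1) unfolding leaves_def L_def by auto
  next
    case False
    define Good where "Good = {a \<in> lists {v. nzE v}. \<not> leaves a}"
    have "countable Good"
      unfolding Good_def by (rule countable_subset[OF _ countable_lists[OF countable_nzE]]) blast
    moreover have "[] \<in> Good" using False by (simp add: Good_def)
    ultimately obtain Z S where Z: "Z \<in> U" "Z \<preceq>\<^sup>* Y0" "S 0 = []" "\<And>k. S k \<in> Good"
      "\<And>k. S (Suc k) = S k @ [Z k]"
    proof (rule generic_run[OF Y0, where nxt="\<lambda>a y a'. a' = a @ [y]"])
      fix a Y assume "a \<in> Good" "Y \<in> U" "Y \<preceq>\<^sup>* Y0"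
      then show "\<exists>y\<in>span_seq Y. nzE y \<and> (\<exists>a'\<in>Good. a' = a @ [y])"
        using step[of a Y] by (auto simp: Good_def)
    qed blast
    have "S k = map Z [0..<k]" for k by (induction k) (use Z in auto)
    then have Sk: "\<not> leaves (map Z [0..<k])" for k using Z(4)[of k] by (simp add: Good_def)
    have "map Z [0..<k] \<in> T" for k
    proof (rule ccontr)
      assume "map Z [0..<k] \<notin> T"
      then have "L (map Z [0..<k]) Y0" unfolding L_def by (intro ballI impI exI[of _ "[]"]) simp
      then show False using Sk[of k] Y0 below_imp_star[of Y0 Y0] by (auto simp: leaves_def below_def)
    qed
    then show thesis using that(2) Z by blast
  qed
qed

end

context strategic_filter begin

section \<open>A parametrized pigeonhole principle\<close>

text \<open>In forcing terms, the condition forces the negation of \<open>\<Phi>\<close>.\<close>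

definition avoids where
  "avoids \<Phi> Y q \<longleftrightarrow> (\<forall>Y' q'. extends Y' q' Y q \<longrightarrow> \<not> \<Phi> Y' q')"

lemma avoids_extends: "avoids \<Phi> Y q \<Longrightarrow> extends Y' q' Y q \<Longrightarrow> avoids \<Phi> Y' q'"
  unfolding avoids_def using extends_trans by blast

text \<open>Density is automatic: a condition that has no extension with \<open>\<Phi> i\<close>
  avoids \<open>\<Phi> i\<close> itself.\<close>

lemma fusion_decide:
  fixes \<Phi> :: "'i \<Rightarrow> (nat \<Rightarrow> 'f vec) \<Rightarrow> bool list set \<Rightarrow> bool"
  assumes c0: "cond Y0 q0" and I: "countable I"
    and hered: "\<And>i Y q Y' q'. i \<in> I \<Longrightarrow> \<Phi> i Y q \<Longrightarrow> cond Y q \<Longrightarrow> extends Y' q' Y q \<Longrightarrow> \<Phi> i Y' q'"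
  obtains Y q N where "extends Y q Y0 q0"
    "\<And>i t. i \<in> I \<Longrightarrow> t \<in> q \<Longrightarrow> N i \<le> length t \<Longrightarrow>
       \<Phi> i Y (subtree q t) \<or> avoids (\<Phi> i) Y (subtree q t)"
proof (rule fusion[OF c0 I, where \<Phi>="\<lambda>i Y q. \<Phi> i Y q \<or> avoids (\<Phi> i) Y q"])
  fix i Y q assume "extends Y q Y0 q0"
  then show "\<exists>Y' q'. extends Y' q' Y q \<and> (\<Phi> i Y' q' \<or> avoids (\<Phi> i) Y' q')"
    using extends_refl[OF extends_cond] unfolding avoids_def by blast
next
  fix i Y q Y' q' assume "i \<in> I" "\<Phi> i Y q \<or> avoids (\<Phi> i) Y q" "cond Y q" "extends Y' q' Y q"
  then show "\<Phi> i Y' q' \<or> avoids (\<Phi> i) Y' q'" using hered avoids_extends by blast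
qed (use that in blast)

text \<open>Openness in \<open>f\<close> enters twice: it passes from missed finite spans to a
  missed limit branch, and it strengthens a miss by some branch through each node to a miss by all
  branches, as far as finite spans are concerned.\<close>

lemma pigeonhole:
  fixes D :: "(nat \<Rightarrow> bool) \<Rightarrow> 'f vec set"
  assumes c0: "cond Y0 q0"
    and op: "\<And>f v. f \<in> branches q0 \<Longrightarrow> v \<in> D f \<Longrightarrow>
      \<exists>n. \<forall>g\<in>branches q0. (\<forall>i<n. g i = f i) \<longrightarrow> v \<in> D g"
  obtains Y q where "extends Y q Y0 q0" "\<And>f. f \<in> branches q \<Longrightarrow> span_seq Y \<inter> D f = {}"
  | Y q where "extends Y q Y0 q0"
    "\<And>f V. f \<in> branches q \<Longrightarrow> V \<in> Einf \<Longrightarrow> V \<preceq> Y \<Longrightarrow> span_seq V \<inter> D f \<noteq> {}"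
proof -
  \<comment> \<open>The vectors of \<open>a\<close> are already chosen and \<open>Z\<close> is the
    undetermined rest. Only \<open>Z\<close> in \<open>U\<close> count here; the second alternative
    of the lemma speaks of all block sequences and needs \<open>leave_or_run\<close>.\<close>
  define hits where "hits a Y q \<longleftrightarrow>
    (\<forall>f\<in>branches q. \<forall>Z\<in>U. Z \<preceq>\<^sup>* Y \<longrightarrow> span_seq (cat_seq a Z) \<inter> D f \<noteq> {})" for a Y q
  have hits_mono: "hits a Y q \<Longrightarrow> cond Y q \<Longrightarrow> extends Y' q' Y q \<Longrightarrow> hits a Y' q'" for a Y q Y' q'
    unfolding hits_def extends_def cond_def using U_star_trans branches_mono by blast
  show thesis
  proof (cases "avoids (hits []) Y0 q0")
    case False
    then obtain Y1 q1 where ext1: "extends Y1 q1 Y0 q0" and hits1: "hits [] Y1 q1"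
      by (auto simp: avoids_def)
    have Y1: "Y1 \<in> U" using ext1 by (simp add: extends_def)
    have b1: "f \<in> branches q0" if "f \<in> branches q1" for f
      using that ext1 branches_mono by (auto simp: extends_def)
    \<comment> \<open>A run through \<open>T\<close> would, by compactness of the branches, produce
      one \<open>f\<close> missed by the whole span of \<open>Z\<close>, against
      \<open>hits1\<close>.\<close>
    define T where "T = {a. \<exists>f\<in>branches q1. fspan a \<inter> D f = {}}"
    show thesis
    proof (rule leave_or_run[OF Y1, of T])
      fix Y assume Y: "Y \<in> U" "Y \<preceq>\<^sup>* Y1"
        "\<And>V. V \<in> Einf \<Longrightarrow> V \<preceq>\<^sup>* Y \<Longrightarrow> \<exists>ys. set ys \<subseteq> span_seq V \<and> ys \<notin> T"
      have "extends Y q1 Y1 q1" using Y ext1 by (auto simp: extends_def)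
      moreover have "span_seq V \<inter> D f \<noteq> {}" if f: "f \<in> branches q1" and V: "V \<in> Einf" "V \<preceq> Y" for f V
      proof -
        obtain ys where ys: "set ys \<subseteq> span_seq V" "ys \<notin> T" using Y(3)[OF V(1) below_imp_star[OF V(2)]] by blast
        then show ?thesis using f fspan_subset_span[OF ys(1)] by (auto simp: T_def)
      qed
      ultimately show thesis using that(2) extends_trans[OF _ ext1] by blast
    next
      fix Z assume Z: "Z \<in> U" "Z \<preceq>\<^sup>* Y1" "\<And>k. map Z [0..<k] \<in> T"
      from Z(3) have "\<forall>k. \<exists>f. f \<in> branches q1 \<and> fspan (map Z [0..<k]) \<inter> D f = {}" by (auto simp: T_def)
      then obtain F where F: "\<And>k. F k \<in> branches q1" "\<And>k. fspan (map Z [0..<k]) \<inter> D (F k) = {}" by metis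
      obtain f where f: "f \<in> branches q1" "\<And>m k. \<exists>n\<ge>k. \<forall>i<m. F n i = f i"
        using branches_compact[of F q1] F(1) by metis
      have "v \<notin> D f" if v: "v \<in> span_seq Z" for v
      proof
        assume vD: "v \<in> D f"
        obtain k where k: "v \<in> fspan (map Z [0..<k])" using span_seq_fspan[OF v] .
        obtain m where m: "\<forall>g\<in>branches q0. (\<forall>i<m. g i = f i) \<longrightarrow> v \<in> D g" using op[OF b1[OF f(1)] vD] by blast
        obtain n where n: "n \<ge> k" "\<forall>i<m. F n i = f i" using f(2) by blast
        then have "v \<in> D (F n)" using m b1[OF F(1)] by blast
        moreover have "set (map Z [0..<k]) \<subseteq> set (map Z [0..<n])" using n(1) by auto
        then have "v \<in> fspan (map Z [0..<n])" using k fspan_mono by blast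
        ultimately show False using F(2) by blast
      qed
      then have "span_seq Z \<inter> D f = {}" by blast
      moreover have "cat_seq [] Z = Z" by (simp add: cat_seq_def)
      moreover have "span_seq (cat_seq [] Z) \<inter> D f \<noteq> {}"
        using hits1 f(1) Z(1,2) unfolding hits_def by blast
      ultimately show thesis by simp
    qed
  next
    case True
    obtain Y q N where ext: "extends Y q Y0 q0"
      and N: "\<And>a t. a \<in> lists {v. nzE v} \<Longrightarrow> t \<in> q \<Longrightarrow> N a \<le> length t \<Longrightarrow>
        hits a Y (subtree q t) \<or> avoids (hits a) Y (subtree q t)"
      by (rule fusion_decide[OF c0 countable_lists[OF countable_nzE], where \<Phi>=hits])
        (use hits_mono in blast)+
    have c: "cond Y q" using ext by (rule extends_cond)
    have YU: "Y \<in> U" and pq: "perfect_tree q" using c by (auto simp: cond_def)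
    have bq: "f \<in> branches q0" if "f \<in> branches (subtree q t)" for f t
      using that ext branches_mono[of q q0] by (auto simp: extends_def branches_subtree)
    have miss: "\<exists>f\<in>branches q'. \<exists>Z\<in>U. Z \<preceq> Z0 \<and> span_seq (cat_seq a Z) \<inter> D f = {}"
      if av: "avoids (hits a) Y' q'" and c': "cond Y' q'" and Z0: "Z0 \<in> U" "Z0 \<preceq>\<^sup>* Y'" for a Y' q' Z0
    proof -
      have "extends Z0 q' Y' q'" using c' Z0 by (auto simp: extends_def cond_def)
      then obtain f Z where Z: "f \<in> branches q'" "Z \<in> U" "Z \<preceq>\<^sup>* Z0" "span_seq (cat_seq a Z) \<inter> D f = {}"
        using av unfolding avoids_def hits_def by blast
      then obtain Z' where "Z' \<in> U" "Z' \<preceq> Z0" "Z' \<preceq> Z" using star_refine by metis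
      then show ?thesis using Z span_cat_mono by blast
    qed
    \<comment> \<open>One \<open>Z\<close> serves finitely many nodes: missing persists when
      \<open>Z\<close> shrinks, so \<open>miss\<close> is applied at one node after the
      other.\<close>
    have miss_all: "\<exists>Z\<in>U. Z \<preceq> Y' \<and> (\<forall>t\<in>T. \<exists>f\<in>branches (subtree q t). span_seq (cat_seq a Z) \<inter> D f = {})"
      if "finite T" "T \<subseteq> q" "\<forall>t\<in>T. avoids (hits a) Y (subtree q t)" and Y': "Y' \<in> U" "Y' \<preceq>\<^sup>* Y" for T a Y'
      using that(1-3)
    proof (induction T rule: finite_induct)
      case empty
      then show ?case using Y' by (auto simp: below_def)
    next
      case (insert t T)
      then obtain Z where Z: "Z \<in> U" "Z \<preceq> Y'"
        "\<forall>t\<in>T. \<exists>f\<in>branches (subtree q t). span_seq (cat_seq a Z) \<inter> D f = {}" by auto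
      have "Z \<preceq>\<^sup>* Y" using Z Y' U_star_trans YU below_imp_star by blast
      moreover have "cond Y (subtree q t)" using cond_subtree[OF c] insert.prems extends_cond by blast
      ultimately obtain f Z' where Z': "f \<in> branches (subtree q t)" "Z' \<in> U" "Z' \<preceq> Z"
        "span_seq (cat_seq a Z') \<inter> D f = {}"
        using miss[of a Y "subtree q t" Z] insert.prems(2) Z(1) by (meson insertI1)
      have "\<forall>s\<in>insert t T. \<exists>f\<in>branches (subtree q s). span_seq (cat_seq a Z') \<inter> D f = {}"
      proof
        fix s assume "s \<in> insert t T"
        then consider "s = t" | "s \<in> T" by blast
        then show "\<exists>f\<in>branches (subtree q s). span_seq (cat_seq a Z') \<inter> D f = {}"
        proof cases
          case 1
          then show ?thesis using Z'(1,4) by blast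
        next
          case 2
          then show ?thesis using bspec[OF Z(3) 2] span_cat_mono[OF Z'(3), of a] by blast
        qed
      qed
      moreover have "Z' \<preceq> Y'" using Z'(3) Z(2) by (rule below_trans)
      ultimately show ?case using Z'(2) by blast
    qed
    \<comment> \<open>For the finite part every branch through \<open>t\<close> misses: a vector
      \<open>v\<close> in \<open>D f\<close> would lie in \<open>D g\<close> for all
      \<open>g\<close> through some node of \<open>f\<close> extending \<open>t\<close>, while
      avoidance persists at that node and supplies a \<open>g\<close> that misses.\<close>
    have fspan_avoid: "fspan a \<inter> D f = {}"
      if av: "avoids (hits a) Y (subtree q t)" and t: "t \<in> q" and f: "f \<in> branches (subtree q t)" for a t f
    proof (rule ccontr)
      assume "fspan a \<inter> D f \<noteq> {}"
      then obtain v where v: "v \<in> fspan a" "v \<in> D f" by blast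
      obtain n where n: "\<forall>g\<in>branches q0. (\<forall>i<n. g i = f i) \<longrightarrow> v \<in> D g" using op[OF bq[OF f] v(2)] by blast
      define t' where "t' = map f [0..<max n (length t)]"
      have fq: "f \<in> branches q" "map f [0..<length t] = t" using f by (auto simp: branches_subtree)
      have t': "t' \<in> q" unfolding t'_def by (rule branches_node[OF fq(1)])
      have pt: "prefix t t'" using prefix_map_upt[of "length t" "max n (length t)" f] fq(2) by (simp add: t'_def)
      have e': "extends Y (subtree q t') Y (subtree q t)"
        using c perfect_subtree[OF pq t'] subtree_mono[OF order_refl pt]
        by (auto simp: extends_def cond_def below_imp_star below_def)
      then obtain g Z where g: "g \<in> branches (subtree q t')" "span_seq (cat_seq a Z) \<inter> D g = {}"
        using miss[OF avoids_extends[OF av e'] extends_cond[OF e'] YU] by (auto simp: below_imp_star below_def)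
      have "map g [0..<length t'] = map f [0..<length t']" using g(1) by (simp add: branches_subtree t'_def)
      then have "\<forall>i<length t'. g i = f i" by (simp only: map_upt_eq_iff)
      then have "v \<in> D g" using n bq[OF g(1)] by (simp add: t'_def)
      then show False using g(2) v(1) fspan_subset_cat by blast
    qed
    \<comment> \<open>A state holds the vectors chosen so far and a finite front of nodes; each move
      appends a vector and splits every node of the front.\<close>
    define Good where "Good = {(a, T). a \<in> lists {v. nzE v} \<and> finite T \<and> T \<subseteq> q \<and>
      (\<forall>t\<in>T. avoids (hits a) Y (subtree q t))}"
    define nxt where "nxt = (\<lambda>(a :: 'f vec list, T :: bool list set) y (a', T'). a' = a @ [y] \<and> (\<forall>t'\<in>T'. \<exists>t\<in>T. prefix t t') \<and>
      (\<forall>t\<in>T. \<exists>u\<in>T'. \<exists>v\<in>T'. prefix t u \<and> prefix t v \<and> \<not> prefix u v \<and> \<not> prefix v u))"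
    have "countable Good"
      by (rule countable_subset[of _ "lists {v. nzE v} \<times> {T. finite T}"])
        (auto simp: Good_def countable_nzE countable_Collect_finite)
    moreover have "([], {[]}) \<in> Good"
      using perfect_Nil[OF pq] avoids_extends[OF True ext] by (simp add: Good_def subtree_Nil)
    ultimately obtain Z S where Z: "Z \<in> U" "Z \<preceq>\<^sup>* Y" and S0: "S 0 = ([], {[]})"
      and SG: "\<And>k. S k \<in> Good" and Sn: "\<And>k. nxt (S k) (Z k) (S (Suc k))"
    proof (rule generic_run[OF YU, where nxt=nxt])
      fix st Y' assume st: "st \<in> Good" and Y': "Y' \<in> U" "Y' \<preceq>\<^sup>* Y"
      obtain a T where aT: "st = (a, T)" by (cases st)
      have a: "a \<in> lists {v. nzE v}" and T: "finite T" "T \<subseteq> q" "\<forall>t\<in>T. avoids (hits a) Y (subtree q t)"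
        using st by (auto simp: aT Good_def)
      obtain Z where Z: "Z \<in> U" "Z \<preceq> Y'" "\<forall>t\<in>T. \<exists>f\<in>branches (subtree q t). span_seq (cat_seq a Z) \<inter> D f = {}"
        using miss_all[OF T Y'] by blast
      define y where "y = Z 0"
      have y: "y \<in> span_seq Y'" "nzE y"
        using Z in_span_seq[of Z 0] Einf_nz[OF U_Einf] by (auto simp: y_def below_def)
      then have ay: "a @ [y] \<in> lists {v. nzE v}" using a by simp
      have ext_node: "\<exists>u v. u \<in> q \<and> v \<in> q \<and> prefix t u \<and> prefix t v \<and> \<not> prefix u v \<and> \<not> prefix v u \<and>
          avoids (hits (a @ [y])) Y (subtree q u) \<and> avoids (hits (a @ [y])) Y (subtree q v)" if t: "t \<in> T" for t
      proof -
        obtain f where f: "f \<in> branches (subtree q t)" "span_seq (cat_seq a Z) \<inter> D f = {}" using Z(3) t by blast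
        then have fq: "f \<in> branches q" "map f [0..<length t] = t" by (auto simp: branches_subtree)
        \<comment> \<open>Long enough for \<open>hits (a @ [y])\<close> to be decided. The branch
          \<open>f\<close> and the tail of \<open>Z\<close> refute it, so it is avoided.\<close>
        define r where "r = map f [0..<max (N (a @ [y])) (length t)]"
        have r: "r \<in> q" unfolding r_def by (rule branches_node[OF fq(1)])
        have tr: "prefix t r" using prefix_map_upt[of "length t" "max (N (a @ [y])) (length t)" f] fq(2) by (simp add: r_def)
        have "\<not> hits (a @ [y]) Y (subtree q r)"
        proof
          assume h: "hits (a @ [y]) Y (subtree q r)"
          have "f \<in> branches (subtree q r)" unfolding r_def by (rule branches_subtree_self[OF fq(1)])
          moreover have "tail 1 Z \<preceq>\<^sup>* Y"
            using below_trans[OF tail_below Z(2), of 1] Y' U_star_trans[OF below_imp_star Y'(2) U_tail[OF Z(1)] Y'(1), of 1]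
            by blast
          ultimately have "span_seq (cat_seq (a @ [y]) (tail 1 Z)) \<inter> D f \<noteq> {}"
            using h U_tail[OF Z(1), of 1] unfolding hits_def by blast
          then show False using f(2) by (simp only: y_def cat_seq_snoc)
        qed
        then have av: "avoids (hits (a @ [y])) Y (subtree q r)" using N[OF ay r] by (simp add: r_def)
        obtain w where w: "r @ w @ [False] \<in> q" "r @ w @ [True] \<in> q" using perfect_split[OF pq r] .
        have "avoids (hits (a @ [y])) Y (subtree q s)" if s: "s \<in> q" "prefix r s" for s
        proof (rule avoids_extends[OF av])
          show "extends Y (subtree q s) Y (subtree q r)"
            using c perfect_subtree[OF pq s(1)] subtree_mono[OF order_refl s(2)]
            by (auto simp: extends_def cond_def below_imp_star below_def)
        qed
        then show ?thesis
          using w tr by (intro exI[of _ "r @ w @ [False]"] exI[of _ "r @ w @ [True]"]) (auto simp: prefix_order.trans[OF tr])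
      qed
      then obtain u v where uv: "\<And>t. t \<in> T \<Longrightarrow> u t \<in> q \<and> v t \<in> q \<and> prefix t (u t) \<and> prefix t (v t) \<and>
          \<not> prefix (u t) (v t) \<and> \<not> prefix (v t) (u t) \<and>
          avoids (hits (a @ [y])) Y (subtree q (u t)) \<and> avoids (hits (a @ [y])) Y (subtree q (v t))"
        by metis
      define T' where "T' = u ` T \<union> v ` T"
      have "(a @ [y], T') \<in> Good" using ay T(1) uv by (auto simp: Good_def T'_def)
      moreover have "nxt st y (a @ [y], T')" unfolding nxt_def aT using uv by (auto simp: T'_def)
      ultimately show "\<exists>y\<in>span_seq Y'. nzE y \<and> (\<exists>st'\<in>Good. nxt st y st')" using y by blast
    qed blast
    define T where "T k = snd (S k)" for k
    have fstS: "fst (S k) = map Z [0..<k]" for k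
    proof (induction k)
      case 0
      then show ?case by (simp add: S0)
    next
      case (Suc k)
      then show ?case using Sn[of k] by (auto simp: nxt_def split: prod.splits)
    qed
    have Tn: "(\<forall>t'\<in>T (Suc k). \<exists>t\<in>T k. prefix t t') \<and>
      (\<forall>t\<in>T k. \<exists>u\<in>T (Suc k). \<exists>v\<in>T (Suc k). prefix t u \<and> prefix t v \<and> \<not> prefix u v \<and> \<not> prefix v u)" for k
      using Sn[of k] unfolding nxt_def T_def by (simp split: prod.splits)
    have TG: "finite (T k) \<and> T k \<subseteq> q \<and> (\<forall>t\<in>T k. avoids (hits (map Z [0..<k])) Y (subtree q t))" for k
      using SG[of k] fstS[of k] by (auto simp: Good_def T_def split: prod.splits)
    define r where "r = {u. \<exists>n. \<exists>t\<in>T n. prefix u t}"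
    have T0: "T 0 \<noteq> {}" by (simp add: T_def S0)
    note scheme = perfect_scheme[of T, OF _ T0, folded r_def]
    have pr: "perfect_tree r" by (rule scheme(1)) (use TG Tn in blast)+
    have "r \<subseteq> q" using TG perfect_prefix[OF pq] by (fastforce simp: r_def)
    then have "extends Z r Y q" using Z pr by (simp add: extends_def)
    \<comment> \<open>A vector of the span uses finitely many terms of \<open>Z\<close>, so it lies
      in the finite span of some stage \<open>k\<close>; as \<open>f\<close> passes through a node
      of \<open>T k\<close>, \<open>fspan_avoid\<close> applies.\<close>
    moreover have "span_seq Z \<inter> D f = {}" if f: "f \<in> branches r" for f
    proof -
      have "v \<notin> D f" if v: "v \<in> span_seq Z" for v
      proof -
        obtain k where k: "v \<in> fspan (map Z [0..<k])" using span_seq_fspan[OF v] .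
        have "\<exists>t\<in>T k. map f [0..<length t] = t" by (rule scheme(2)[OF _ _ _ f]) (use TG Tn in blast)+
        then obtain t where t: "t \<in> T k" "map f [0..<length t] = t" by blast
        then have "f \<in> branches (subtree q t)"
          using f branches_mono[OF \<open>r \<subseteq> q\<close>] by (auto simp: branches_subtree)
        then show ?thesis using fspan_avoid[of "map Z [0..<k]" t f] TG[of k] t(1) k by blast
      qed
      then show ?thesis by blast
    qed
    ultimately show thesis using that(1) extends_trans[OF _ ext] by blast
  qed
qed

end

section \<open>Open games\<close>

text \<open>II can force the game \<open>G[x,Y]\<close> to reach, after at least one move, a position in \<open>W\<close>.\<close>

inductive reach :: "('f::field vec list \<Rightarrow> bool) \<Rightarrow> (nat \<Rightarrow> 'f vec) \<Rightarrow> 'f vec list \<Rightarrow> bool" for W Y where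
  reachI: "(\<And>V. V \<in> Einf \<Longrightarrow> V \<preceq> Y \<Longrightarrow>
    \<exists>y\<in>span_seq V. after x y \<and> (W (x @ [y]) \<or> reach W Y (x @ [y]))) \<Longrightarrow> reach W Y x"

text \<open>Against a move \<open>V\<close> almost below \<open>Y\<close>, II answers inside a tail
  of \<open>V\<close> that is below \<open>Y\<close>.\<close>

lemma reach_mono:
  assumes "reach W Y x" "Y' \<preceq>\<^sup>* Y" "Y' \<in> Einf"
  shows "reach W Y' x"
  using assms(1)
proof (induction x rule: reach.induct)
  case (reachI x)
  show ?case
  proof (rule reach.reachI)
    fix V assume V: "V \<in> Einf" "V \<preceq> Y'"
    then have "V \<preceq>\<^sup>* Y" using below_star_trans[OF below_imp_star assms(2)] assms(3) by blast
    then obtain m where "tail m V \<preceq> Y" by (auto simp: below_star_def)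
    then obtain y where "y \<in> span_seq (tail m V)" "after x y" "W (x @ [y]) \<or> reach W Y' (x @ [y])"
      using reachI tail_Einf[OF V(1)] by blast
    then show "\<exists>y\<in>span_seq V. after x y \<and> (W (x @ [y]) \<or> reach W Y' (x @ [y]))"
      using tail_below[where m=m and Y=V] by (auto simp: below_def)
  qed
qed

text \<open>Finite runs of the game F[x,Y] with I playing \<open>\<tau>\<close>, recorded by the
  moves \<open>ys\<close> of II.\<close>

definition follows :: "'f::field vec list \<Rightarrow> (nat \<Rightarrow> 'f vec) \<Rightarrow> ('f vec list \<Rightarrow> nat) \<Rightarrow> 'f vec list \<Rightarrow> bool" where
  "follows x Y \<tau> ys \<longleftrightarrow> (\<forall>k<length ys. ys ! k \<in> span_seq Y \<and> after (x @ take k ys) (ys ! k) \<and>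
     \<tau> (take k ys) < Min (supp (ys ! k)))"

lemma follows_snoc:
  "follows x Y \<tau> (ys @ [y]) \<longleftrightarrow> follows x Y \<tau> ys \<and> y \<in> span_seq Y \<and> after (x @ ys) y \<and> \<tau> ys < Min (supp y)"
  unfolding follows_def by (auto simp: nth_append less_Suc_eq)

context strategic_filter begin

lemma extends_branch:
  assumes "extends Y q Y1 q1" "f \<in> branches q" "n \<le> m"
  shows "extends Y (subtree q (map f [0..<m])) Y1 (subtree q1 (map f [0..<n]))"
  using assms perfect_subtree[of q "map f [0..<m]"] branches_node[OF assms(2), of m]
    subtree_mono[OF _ prefix_map_upt[OF assms(3)]]
  by (auto simp: extends_def)

text \<open>Different fusions decide at different levels \<open>n\<close> and \<open>m\<close> of
  the branch; at level \<open>max n m\<close> both pieces of information meet and conflict.\<close>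

lemma avoids_branch:
  assumes ext: "extends Y q Y1 q1" and f: "f \<in> branches q"
    and av: "avoids \<Phi> Y1 (subtree q1 (map f [0..<n]))"
    and hered: "\<And>Y q Y' q'. \<Phi> Y q \<Longrightarrow> cond Y q \<Longrightarrow> extends Y' q' Y q \<Longrightarrow> \<Phi> Y' q'"
  shows "\<not> \<Phi> Y (subtree q (map f [0..<m]))"
proof
  assume P: "\<Phi> Y (subtree q (map f [0..<m]))"
  have r: "extends Y q Y q" by (rule extends_refl[OF extends_cond[OF ext]])
  have "\<Phi> Y (subtree q (map f [0..<max n m]))"
    using hered[OF P] extends_branch[OF r f, of m "max n m"] extends_branch[OF r f order_refl, of m] extends_cond
    by fastforce
  then show False using av extends_branch[OF ext f, of n "max n m"] by (simp add: avoids_def)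
qed

text \<open>Once it is decided from which finite \<open>a\<close> II can force \<open>W f\<close>,
  the moves that bring II to \<open>W f\<close> or to such a position form the set
  \<open>D a f\<close>. By the pigeonhole principle at each \<open>a\<close>, either II can always
  enter \<open>D a f\<close>, and so wins from \<open>a\<close>, or I keeps all moves out of it by
  playing large numbers.\<close>

lemma open_dichotomy:
  fixes W :: "(nat \<Rightarrow> bool) \<Rightarrow> 'f vec list \<Rightarrow> bool"
  assumes c0: "cond Y0 q0" and x: "x \<in> lists {v. nzE v}"
    and op: "\<And>f a. f \<in> branches q0 \<Longrightarrow> W f a \<Longrightarrow>
      \<exists>n. \<forall>g\<in>branches q0. (\<forall>i<n. g i = f i) \<longrightarrow> W g a"
  obtains Y q where "extends Y q Y0 q0" "\<And>f. f \<in> branches q \<Longrightarrow> reach (W f) Y x"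
  | Y q \<tau> where "extends Y q Y0 q0"
    "\<And>f ys. f \<in> branches q \<Longrightarrow> follows x Y \<tau> ys \<Longrightarrow> ys \<noteq> [] \<Longrightarrow> \<not> W f (x @ ys)"
proof -
  let ?I = "lists {v :: 'f vec. nzE v}"
  have cI: "countable ?I" by (rule countable_lists[OF countable_nzE])
  define G where "G a Y q \<longleftrightarrow> (\<forall>f\<in>branches q. reach (W f) Y a)" for a Y q
  have G_hered: "G a Y' q'" if "G a Y q" "cond Y q" "extends Y' q' Y q" for a Y q Y' q'
    using that reach_mono branches_mono U_Einf unfolding G_def extends_def by blast
  obtain Y1 q1 N where ext1: "extends Y1 q1 Y0 q0"
    and N: "\<And>a t. a \<in> ?I \<Longrightarrow> t \<in> q1 \<Longrightarrow> N a \<le> length t \<Longrightarrow>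
      G a Y1 (subtree q1 t) \<or> avoids (G a) Y1 (subtree q1 t)"
    by (rule fusion_decide[OF c0 cI, where \<Phi>=G]) (use G_hered in blast)+
  have c1: "cond Y1 q1" by (rule extends_cond[OF ext1])
  have b1: "f \<in> branches q0" if "f \<in> branches q1" for f
    using that ext1 branches_mono by (auto simp: extends_def)
  \<comment> \<open>Finitely many values of \<open>f\<close> confirm membership of \<open>y\<close>:
    those for \<open>W\<close> by hypothesis, and the first \<open>N (a @ [y])\<close> values for
    the decision.\<close>
  define D where "D a f = {y. after a y \<and>
     (W f (a @ [y]) \<or> G (a @ [y]) Y1 (subtree q1 (map f [0..<N (a @ [y])])))}" for a f
  have D_open: "\<exists>n. \<forall>g\<in>branches q1. (\<forall>i<n. g i = f i) \<longrightarrow> y \<in> D a g"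
    if f: "f \<in> branches q1" and y: "y \<in> D a f" for a f y
  proof (cases "W f (a @ [y])")
    case True
    then obtain n where "\<forall>g\<in>branches q0. (\<forall>i<n. g i = f i) \<longrightarrow> W g (a @ [y])" using op[OF b1[OF f]] by blast
    then show ?thesis using y b1 unfolding D_def by blast
  next
    case False
    then have G: "G (a @ [y]) Y1 (subtree q1 (map f [0..<N (a @ [y])]))" using y by (auto simp: D_def)
    have "y \<in> D a g" if "\<forall>i<N (a @ [y]). g i = f i" for g
    proof -
      have "map g [0..<N (a @ [y])] = map f [0..<N (a @ [y])]" using that by (simp only: map_upt_eq_iff)
      then have "G (a @ [y]) Y1 (subtree q1 (map g [0..<N (a @ [y])]))" using G by (simp only:)
      moreover have "after a y" using y by (simp add: D_def)
      ultimately show ?thesis unfolding D_def by blast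
    qed
    then show ?thesis by blast
  qed
  \<comment> \<open>The bound \<open>m\<close> makes the second alternative hereditary: a sequence
    almost below \<open>Y\<close> satisfies it with a larger bound.\<close>
  define Q where "Q a Y q \<longleftrightarrow> G a Y q \<or>
    (\<exists>m. \<forall>f\<in>branches q. \<forall>y\<in>span_seq Y. nzE y \<and> m < Min (supp y) \<longrightarrow> y \<notin> D a f)" for a Y q
  obtain Y2 q2 M where ext2: "extends Y2 q2 Y1 q1"
    and M: "\<And>a t. a \<in> ?I \<Longrightarrow> t \<in> q2 \<Longrightarrow> M a \<le> length t \<Longrightarrow> Q a Y2 (subtree q2 t)"
  proof (rule fusion[OF c1 cI, where \<Phi>=Q])
    fix a Y q assume a: "a \<in> ?I" and ext: "extends Y q Y1 q1"
    have bq: "f \<in> branches q1" if "f \<in> branches q" for f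
      using that ext branches_mono by (auto simp: extends_def)
    show "\<exists>Y' q'. extends Y' q' Y q \<and> Q a Y' q'"
    proof (rule pigeonhole[OF extends_cond[OF ext], where D="D a"])
      fix f y assume "f \<in> branches q" "y \<in> D a f"
      then show "\<exists>n. \<forall>g\<in>branches q. (\<forall>i<n. g i = f i) \<longrightarrow> y \<in> D a g"
        using D_open[of f y a] bq by blast
    next
      fix Y' q' assume "extends Y' q' Y q" "\<And>f. f \<in> branches q' \<Longrightarrow> span_seq Y' \<inter> D a f = {}"
      then show ?thesis unfolding Q_def by blast
    next
      fix Y' q' assume ext': "extends Y' q' Y q"
        and hit: "\<And>f V. f \<in> branches q' \<Longrightarrow> V \<in> Einf \<Longrightarrow> V \<preceq> Y' \<Longrightarrow> span_seq V \<inter> D a f \<noteq> {}"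
      have "reach (W f) Y' a" if f: "f \<in> branches q'" for f
      proof (rule reachI)
        fix V assume V: "V \<in> Einf" "V \<preceq> Y'"
        obtain y where y: "y \<in> span_seq V" "y \<in> D a f" using hit[OF f V] by blast
        have "f \<in> branches q" using f ext' branches_mono by (auto simp: extends_def)
        then have f1: "f \<in> branches q1" by (rule bq)
        have "extends Y' q' Y1 q1" by (rule extends_trans[OF ext' ext])
        then have "reach (W f) Y' (a @ [y])" if "reach (W f) Y1 (a @ [y])"
          using reach_mono[OF that] U_Einf by (auto simp: extends_def)
        then have "W f (a @ [y]) \<or> reach (W f) Y' (a @ [y])"
          using y(2) branches_subtree_self[OF f1] by (auto simp: D_def G_def)
        then show "\<exists>y\<in>span_seq V. after a y \<and> (W f (a @ [y]) \<or> reach (W f) Y' (a @ [y]))"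
          using y by (auto simp: D_def)
      qed
      then show ?thesis using ext' unfolding Q_def G_def by blast
    qed
  next
    fix a Y q Y' q' assume "Q a Y q" and c: "cond Y q" and ext: "extends Y' q' Y q"
    then consider "G a Y q" | m where "\<forall>f\<in>branches q. \<forall>y\<in>span_seq Y. nzE y \<and> m < Min (supp y) \<longrightarrow> y \<notin> D a f"
      unfolding Q_def by blast
    then show "Q a Y' q'"
    proof cases
      case 1
      then show ?thesis using G_hered c ext unfolding Q_def by blast
    next
      case (2 m)
      obtain k where "\<forall>v\<in>span_seq Y'. nzE v \<and> k < Min (supp v) \<longrightarrow> v \<in> span_seq Y"
        using ext below_star_iff U_Einf unfolding extends_def by blast
      moreover have "branches q' \<subseteq> branches q" using ext branches_mono by (auto simp: extends_def)
      ultimately have "\<forall>f\<in>branches q'. \<forall>y\<in>span_seq Y'. nzE y \<and> max k m < Min (supp y) \<longrightarrow> y \<notin> D a f"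
        using 2 by auto
      then show ?thesis unfolding Q_def by blast
    qed
  qed blast
  have c2: "cond Y2 q2" by (rule extends_cond[OF ext2])
  have pq2: "perfect_tree q2" and YU2: "Y2 \<in> U" using c2 by (auto simp: cond_def)
  have b2: "f \<in> branches q1" if "f \<in> branches q2" for f
    using that ext2 branches_mono by (auto simp: extends_def)
  obtain t where t: "t \<in> q2" "length t = N x"
    by (rule perfect_extend[OF pq2 perfect_Nil[OF pq2], of "N x"]) auto
  have t1: "t \<in> q1" using t ext2 by (auto simp: extends_def)
  have ext3: "extends Y2 (subtree q2 t) Y0 q0"
    using extends_trans[OF cond_subtree[OF c2 t(1)] extends_trans[OF ext2 ext1]] .
  have "G x Y1 (subtree q1 t) \<or> avoids (G x) Y1 (subtree q1 t)" using N[OF x t1] t(2) by simp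
  then show thesis
  proof
    assume "G x Y1 (subtree q1 t)"
    then have "G x Y2 (subtree q2 t)"
      using G_hered extends_subtree[OF ext2 t(1)] cond_subtree[OF c1 t1] extends_cond by blast
    then show thesis using that(1) ext3 unfolding G_def by blast
  next
    assume bad_x: "avoids (G x) Y1 (subtree q1 t)"
    define bad where "bad a f \<longleftrightarrow> avoids (G a) Y1 (subtree q1 (map f [0..<N a]))" for a f
    define safe where "safe a u m \<longleftrightarrow>
      (\<forall>f\<in>branches (subtree q2 u). \<forall>y\<in>span_seq Y2. nzE y \<and> m < Min (supp y) \<longrightarrow> y \<notin> D a f)" for a u and m :: nat
    define m where "m a u = (SOME m. safe a u m)" for a u
    \<comment> \<open>I does not know \<open>f\<close>, so the bounds for all of the finitely many
      nodes of length \<open>M (x @ ys)\<close> are met at once.\<close>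
    define \<tau> where "\<tau> ys = Max (insert 0 (m (x @ ys) ` {u \<in> q2. length u = M (x @ ys)}))" for ys
    have m_le: "m (x @ ys) u \<le> \<tau> ys" if "u \<in> q2" "length u = M (x @ ys)" for ys u
    proof -
      have "finite {u \<in> q2. length u = M (x @ ys)}"
        by (rule finite_subset[OF _ finite_lists_length_eq[of "UNIV::bool set" "M (x @ ys)"]]) auto
      then show ?thesis using that by (auto simp: \<tau>_def intro!: Max_ge)
    qed
    have bad_safe: "safe a (map f [0..<M a]) (m a (map f [0..<M a]))"
      if a: "a \<in> ?I" and f: "f \<in> branches q2" and b: "bad a f" for a f
    proof -
      have "\<not> G a Y2 (subtree q2 (map f [0..<M a]))"
        by (rule avoids_branch[OF ext2 f b[unfolded bad_def]]) (rule G_hered)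
      then have "\<exists>m. safe a (map f [0..<M a]) m"
        using M[OF a branches_node[OF f], of "M a"] unfolding Q_def safe_def by auto
      then show ?thesis unfolding m_def by (rule someI_ex)
    qed
    \<comment> \<open>Along a run with \<open>\<tau>\<close> every position stays bad for
      \<open>f\<close>: the next move misses \<open>D\<close>, so II cannot win from the new
      position, and \<open>N\<close> turns this into avoidance.\<close>
    have "x @ ys \<in> ?I \<and> bad (x @ ys) f \<and> (ys \<noteq> [] \<longrightarrow> \<not> W f (x @ ys))"
      if f: "f \<in> branches (subtree q2 t)" and "follows x Y2 \<tau> ys" for f ys
      using that(2)
    proof (induction ys rule: rev_induct)
      case Nil
      then show ?case using x f bad_x t(2) by (simp add: bad_def branches_subtree)
    next
      case (snoc y ys)
      let ?a = "x @ ys" and ?b = "x @ ys @ [y]"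
      have f2: "f \<in> branches q2" using f by (simp add: branches_subtree)
      have fol: "follows x Y2 \<tau> ys" and y: "y \<in> span_seq Y2" "after ?a y" "\<tau> ys < Min (supp y)"
        using snoc.prems by (auto simp: follows_snoc)
      have IH: "?a \<in> ?I" "bad ?a f" using snoc.IH[OF fol] by auto
      have nz: "nzE y" using y(2) by (simp add: after_def)
      have "m ?a (map f [0..<M ?a]) < Min (supp y)"
        using m_le[of "map f [0..<M ?a]" ys] branches_node[OF f2] y(3) by fastforce
      then have yD: "y \<notin> D ?a f"
        using bad_safe[OF IH(1) f2 IH(2)] branches_subtree_self[OF f2, of "M ?a"] y(1) nz
        unfolding safe_def by blast
      have b: "?b \<in> ?I" using IH(1) nz by simp
      have "\<not> G ?b Y1 (subtree q1 (map f [0..<N ?b]))" using yD y(2) by (simp add: D_def)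
      then have "bad ?b f"
        using N[OF b branches_node[OF b2[OF f2]], of "N ?b"] by (simp add: bad_def)
      moreover have "\<not> W f ?b" using yD y(2) by (simp add: D_def)
      ultimately show ?case using b by simp
    qed
    then show thesis using that(2) ext3 by blast
  qed
qed

end

section \<open>Analytic games\<close>

text \<open>A strategy of II that wins in finitely many moves is a well-founded tree; datatypes with infinite
  branching stand in for ordinal ranks.\<close>

datatype ('m, 'v) wtree = Leaf | Node "'m \<Rightarrow> 'v" "'m \<Rightarrow> ('m, 'v) wtree"

primrec wins :: "('f::field vec list \<Rightarrow> bool) \<Rightarrow> (nat \<Rightarrow> 'f vec) \<Rightarrow>
    ((nat \<Rightarrow> 'f vec), 'f vec) wtree \<Rightarrow> 'f vec list \<Rightarrow> bool" where
  "wins W Y Leaf x = W x"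
| "wins W Y (Node y T) x = (\<forall>V\<in>Einf. V \<preceq> Y \<longrightarrow>
     y V \<in> span_seq V \<and> after x (y V) \<and> wins W Y (T V) (x @ [y V]))"

text \<open>The answers are collected by choice along the induction. The tree is no leaf because
  \<open>reach\<close> demands at least one move.\<close>

lemma reach_wins:
  assumes "reach W Y x"
  obtains T where "T \<noteq> Leaf" "wins W Y T x"
proof -
  have "\<exists>y T. wins W Y (Node y T) x"
    using assms
  proof (induction x rule: reach.induct)
    case (reachI x)
    have "\<exists>y T. V \<in> Einf \<longrightarrow> V \<preceq> Y \<longrightarrow> y \<in> span_seq V \<and> after x y \<and> wins W Y T (x @ [y])" for V
    proof (cases "V \<in> Einf \<and> V \<preceq> Y")
      case True
      then obtain y where y: "y \<in> span_seq V" "after x y"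
        "W (x @ [y]) \<or> (\<exists>y' T. wins W Y (Node y' T) (x @ [y]))"
        using reachI by blast
      have "\<exists>T. wins W Y T (x @ [y])"
        using y(3)
      proof
        assume "W (x @ [y])"
        then show ?thesis by (intro exI[of _ Leaf]) simp
      qed blast
      then show ?thesis using y by blast
    qed blast
    then obtain y T where "\<And>V. V \<in> Einf \<Longrightarrow> V \<preceq> Y \<Longrightarrow> y V \<in> span_seq V \<and> after x (y V) \<and> wins W Y (T V) (x @ [y V])"
      by metis
    then have "wins W Y (Node y T) x" by simp
    then show ?case by blast
  qed
  then show thesis using that by blast
qed

definition child_rel :: "(('m, 'v) wtree \<times> ('m, 'v) wtree) set" where
  "child_rel = {(T V, Node y T) | y T V. True}"

lemma wf_child_rel: "wf child_rel"
proof (rule wfUNIVI)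
  fix P :: "('a, 'b) wtree \<Rightarrow> bool" and x
  assume step: "\<forall>x. (\<forall>y. (y, x) \<in> child_rel \<longrightarrow> P y) \<longrightarrow> P x"
  show "P x"
  proof (induction x)
    case Leaf
    then show ?case using step by (auto simp: child_rel_def)
  next
    case (Node y T)
    then have "\<forall>T'. (T', Node y T) \<in> child_rel \<longrightarrow> P T'" by (auto simp: child_rel_def)
    then show ?case using step by blast
  qed
qed

context strategic_filter begin

text \<open>One unfolding handles both players: \<open>A s\<close> is the union over the next
  coordinate \<open>j\<close> of the pieces \<open>A (s @ [j])\<close>, of which I must avoid all
  and II must reach only one.\<close>

lemma analytic_dichotomy:
  fixes g :: "(nat \<Rightarrow> nat) \<Rightarrow> (nat \<Rightarrow> bool) \<times> (nat \<Rightarrow> 'f vec)"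
  assumes cont: "seq_cont (fst \<circ> g)" "seq_cont (snd \<circ> g)"
    and x: "x \<in> lists {v. nzE v}" and c0: "cond X p"
  obtains Y q \<sigma> where "extends Y q X p" "Y \<preceq> X" "branches q \<times> F_outcomes x Y \<sigma> \<inter> range g = {}"
  | Y q where "extends Y q X p" "Y \<preceq> X"
    "\<And>f. f \<in> branches q \<Longrightarrow> \<exists>\<alpha>. strategy_II_G x Y \<alpha> \<and> G_outcomes x Y \<alpha> \<subseteq> slice_at (range g) f"
proof -
  define A where "A s = g ` {c. \<forall>i<length s. c i = s ! i}" for s
  define Iw where "Iw = (\<lambda>(a, s) Y q. \<exists>\<sigma>. branches q \<times> F_outcomes a Y \<sigma> \<inter> A s = {})"
  have Iw_iff: "Iw (a, s) Y q \<longleftrightarrow> (\<exists>\<sigma>. branches q \<times> F_outcomes a Y \<sigma> \<inter> A s = {})" for a s Y q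
    by (simp add: Iw_def)
  have Iw_hered: "Iw i Y' q'" if Iw: "Iw i Y q" and c: "cond Y q" and ext: "extends Y' q' Y q" for i Y q Y' q'
  proof -
    obtain a s where i: "i = (a, s)" by (cases i)
    obtain \<sigma> where \<sigma>: "branches q \<times> F_outcomes a Y \<sigma> \<inter> A s = {}" using Iw unfolding i Iw_iff by blast
    obtain k where k: "\<And>v. v \<in> span_seq Y' \<Longrightarrow> nzE v \<Longrightarrow> k < Min (supp v) \<Longrightarrow> v \<in> span_seq Y"
      using ext below_star_iff U_Einf unfolding extends_def by blast
    \<comment> \<open>Playing at least \<open>k\<close> forces the moves of II into the span of
      \<open>Y\<close>.\<close>
    have "F_outcomes a Y' (\<lambda>ys. max k (\<sigma> ys)) \<subseteq> F_outcomes a Y \<sigma>"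
      unfolding F_outcomes_def using k by (auto simp: after_def)
    moreover have "branches q' \<subseteq> branches q" using ext branches_mono by (auto simp: extends_def)
    ultimately have "branches q' \<times> F_outcomes a Y' (\<lambda>ys. max k (\<sigma> ys)) \<inter> A s = {}" using \<sigma> by blast
    then show ?thesis unfolding i Iw_iff by blast
  qed
  let ?L = "lists {v :: 'f vec. nzE v}" and ?I = "lists {v :: 'f vec. nzE v} \<times> (UNIV :: nat list set)"
  have cI: "countable ?I" by (intro countable_SIGMA countable_lists countable_nzE) simp
  obtain Y1 q1 N where ext1: "extends Y1 q1 X p"
    and N: "\<And>i t. i \<in> ?I \<Longrightarrow> t \<in> q1 \<Longrightarrow> N i \<le> length t \<Longrightarrow>
      Iw i Y1 (subtree q1 t) \<or> avoids (Iw i) Y1 (subtree q1 t)"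
  proof (rule fusion_decide[OF c0 cI, where \<Phi>=Iw])
    fix i Y q Y' q' assume "Iw i Y q" "cond Y q" "extends Y' q' Y q"
    then show "Iw i Y' q'" by (rule Iw_hered)
  qed (rule that)
  have c1: "cond Y1 q1" by (rule extends_cond[OF ext1])
  \<comment> \<open>The truth value depends only on the first \<open>N (a, s)\<close> values of
    \<open>f\<close>; this makes \<open>W\<close> below open, as \<open>open_dichotomy\<close>
    requires.\<close>
  define live where "live a s f \<longleftrightarrow> avoids (Iw (a, s)) Y1 (subtree q1 (map f [0..<N (a, s)]))" for a s f
  have live_cong: "live a s f' = live a s f" if "\<forall>i<N (a, s). f' i = f i" for a s f f'
  proof -
    have "map f' [0..<N (a, s)] = map f [0..<N (a, s)]" using that by (simp only: map_upt_eq_iff)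
    then show ?thesis by (simp only: live_def)
  qed
  define W where "W s f a \<longleftrightarrow> (\<exists>j. live a (s @ [j]) f)" for s f a
  have W_open: "\<exists>n. \<forall>f'. (\<forall>i<n. f' i = f i) \<longrightarrow> W s f' a" if "W s f a" for s f a
    using that live_cong unfolding W_def by blast
  define Q where "Q = (\<lambda>(a, s) Y q. Iw (a, s) Y q \<or> (\<forall>f\<in>branches q. reach (W s f) Y a))"
  have Q_iff: "Q (a, s) Y q \<longleftrightarrow> Iw (a, s) Y q \<or> (\<forall>f\<in>branches q. reach (W s f) Y a)" for a s Y q
    by (simp add: Q_def)
  obtain Y2 q2 M where ext2: "extends Y2 q2 Y1 q1"
    and M: "\<And>i t. i \<in> ?I \<Longrightarrow> t \<in> q2 \<Longrightarrow> M i \<le> length t \<Longrightarrow> Q i Y2 (subtree q2 t)"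
  proof (rule fusion[OF c1 cI, where \<Phi>=Q])
    fix i Y q Y' q' assume Q: "Q i Y q" "cond Y q" and ext: "extends Y' q' Y q"
    obtain a s where as: "i = (a, s)" by (cases i)
    have b: "branches q' \<subseteq> branches q" using ext branches_mono by (auto simp: extends_def)
    have Y': "Y' \<preceq>\<^sup>* Y" "Y' \<in> Einf" using ext U_Einf by (auto simp: extends_def)
    show "Q i Y' q'"
      using Q(1) Iw_hered[OF _ Q(2) ext, of i] reach_mono[OF _ Y'] b unfolding as Q_iff by blast
  next
    fix i Y q assume i: "i \<in> ?I" and ext: "extends Y q Y1 q1"
    obtain a s where as: "i = (a, s)" by (cases i)
    have a: "a \<in> ?L" using i by (simp add: as)
    show "\<exists>Y' q'. extends Y' q' Y q \<and> Q i Y' q'"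
    proof (rule open_dichotomy[OF extends_cond[OF ext] a, where W="W s"])
      fix Y' q' assume "extends Y' q' Y q" "\<And>f. f \<in> branches q' \<Longrightarrow> reach (W s f) Y' a"
      then show ?thesis unfolding as Q_iff by blast
    next
      fix Y' q' \<tau> assume ext': "extends Y' q' Y q" and
        \<tau>: "\<And>f ys. f \<in> branches q' \<Longrightarrow> follows a Y' \<tau> ys \<Longrightarrow> ys \<noteq> [] \<Longrightarrow> \<not> W s f (a @ ys)"
      have ext'': "extends Y' q' Y1 q1" by (rule extends_trans[OF ext' ext])
      obtain k where k: "\<And>v. v \<in> span_seq Y' \<Longrightarrow> nzE v \<Longrightarrow> k < Min (supp v) \<Longrightarrow> v \<in> span_seq Y1"
        using ext'' below_star_iff U_Einf unfolding extends_def by blast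
      define kills where "kills b r u \<sigma> \<longleftrightarrow> branches (subtree q1 u) \<times> F_outcomes b Y1 \<sigma> \<inter> A r = {}" for b r u \<sigma>
      define \<Sigma> where "\<Sigma> b r u = (SOME \<sigma>. kills b r u \<sigma>)" for b r u
      text \<open>After \<open>i > 0\<close> moves all positions \<open>(a @ take i ys, s @ [j])\<close> are won by I; the winning
        strategies for \<open>j < i\<close> are followed from then on, finitely many at each move.\<close>
      define F where "F ys = (\<lambda>(i, j, u). \<Sigma> (a @ take i ys) (s @ [j]) u (drop i ys)) `
        (SIGMA i:{..length ys}. SIGMA j:{..<i}. {u \<in> q1. length u = N (a @ take i ys, s @ [j])})" for ys
      have fin: "finite (F ys)" for ys
      proof -
        have "finite {u \<in> q1. length u = n}" for n
          by (rule finite_subset[OF _ finite_lists_length_eq[of "UNIV::bool set" n]]) auto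
        then show ?thesis unfolding F_def by (intro finite_imageI finite_SigmaI) auto
      qed
      define \<sigma> where "\<sigma> ys = Max (insert k (insert (\<tau> ys) (F ys)))" for ys
      have \<sigma>k: "k \<le> \<sigma> ys" "\<tau> ys \<le> \<sigma> ys" for ys
        unfolding \<sigma>_def by (rule Max_ge; use fin in simp)+
      have \<sigma>F: "n \<le> \<sigma> ys" if "n \<in> F ys" for n ys
        unfolding \<sigma>_def by (rule Max_ge) (use fin that in simp_all)
      have "(f, z) \<notin> A s" if f: "f \<in> branches q'" and z: "z \<in> F_outcomes a Y' \<sigma>" for f z
      proof
        assume "(f, z) \<in> A s"
        then obtain c where c: "(f, z) = g c" "\<forall>i<length s. c i = s ! i" by (auto simp: A_def)
        obtain ys where ys: "z = cat_seq a ys"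
          "\<And>k. ys k \<in> span_seq Y' \<and> after (a @ map ys [0..<k]) (ys k) \<and> \<sigma> (map ys [0..<k]) < Min (supp (ys k))"
          using z by (auto simp: F_outcomes_def)
        define j where "j = c (length s)"
        \<comment> \<open>With \<open>i = Suc j\<close> the strategy for the piece
          \<open>s @ [j]\<close> is among those with \<open>j < i\<close>, and at least one move has
          been made, as the property of \<open>\<tau>\<close> requires.\<close>
        define i where "i = Suc j"
        define b where "b = map ys [0..<i]"
        have cs: "(f, z) \<in> A (s @ [j])"
          unfolding A_def using c by (auto simp: nth_append less_Suc_eq j_def intro!: image_eqI[of _ _ c])
        have take_ys: "take l (map ys [0..<m]) = map ys [0..<l]" if "l \<le> m" for l m
          using that by (simp add: take_map)
        have fol: "follows a Y' \<tau> b"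
          unfolding follows_def
        proof (intro allI impI)
          fix l assume "l < length b"
          then have l: "l < i" by (simp add: b_def)
          have "\<tau> (map ys [0..<l]) < Min (supp (ys l))"
            using ys(2)[of l] \<sigma>k(2)[of "map ys [0..<l]"] by simp
          then show "b ! l \<in> span_seq Y' \<and> after (a @ take l b) (b ! l) \<and> \<tau> (take l b) < Min (supp (b ! l))"
            using ys(2)[of l] l take_ys[of l i] by (simp add: b_def del: upt_Suc)
        qed
        have "b \<noteq> []" by (simp add: b_def i_def)
        then have nl: "\<not> live (a @ b) (s @ [j]) f" using \<tau>[OF f fol] unfolding W_def by blast
        have f1: "f \<in> branches q1" using f ext'' branches_mono by (auto simp: extends_def)
        have "nzE (ys l)" for l using ys(2)[of l] by (simp add: after_def)
        then have abL: "a @ b \<in> ?L" using a by (auto simp: b_def)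
        define u where "u = map f [0..<N (a @ b, s @ [j])]"
        have u: "u \<in> q1" "length u = N (a @ b, s @ [j])" unfolding u_def using branches_node[OF f1] by auto
        have "Iw (a @ b, s @ [j]) Y1 (subtree q1 u)"
          using N[of "(a @ b, s @ [j])" u] abL u nl by (auto simp: live_def u_def)
        then have "kills (a @ b) (s @ [j]) u (\<Sigma> (a @ b) (s @ [j]) u)"
          unfolding \<Sigma>_def Iw_iff kills_def by (rule someI_ex)
        moreover have "f \<in> branches (subtree q1 u)" unfolding u_def by (rule branches_subtree_self[OF f1])
        \<comment> \<open>From position \<open>a @ b\<close> on, the play obeys the killing
          strategy: \<open>(i, j, u)\<close> is one of the indices in \<open>F\<close>, so its
          number is at most the one I plays.\<close>
        moreover have "z \<in> F_outcomes (a @ b) Y1 (\<Sigma> (a @ b) (s @ [j]) u)"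
        proof -
          define ws where "ws l = ys (l + i)" for l
          have "z = cat_seq (a @ b) ws"
            unfolding ys(1) by (rule HOL.ext) (auto simp: cat_seq_def nth_append b_def ws_def simp del: upt_Suc)
          moreover have "ws l \<in> span_seq Y1 \<and> after ((a @ b) @ map ws [0..<l]) (ws l) \<and>
            \<Sigma> (a @ b) (s @ [j]) u (map ws [0..<l]) < Min (supp (ws l))" for l
          proof -
            let ?m = "map ys [0..<l + i]"
            have split: "?m = b @ map ws [0..<l]"
              by (rule nth_equalityI) (auto simp: b_def ws_def nth_append simp del: upt_Suc)
            have lenb: "length b = i" by (simp add: b_def)
            have "\<Sigma> (a @ b) (s @ [j]) u (map ws [0..<l]) \<in> F ?m"
              unfolding F_def
              by (rule image_eqI[of _ _ "(i, j, u)"])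
                (auto simp: split lenb u i_def[symmetric] simp del: upt_Suc, simp add: i_def)
            then have "\<Sigma> (a @ b) (s @ [j]) u (map ws [0..<l]) \<le> \<sigma> ?m" by (rule \<sigma>F)
            then have "\<Sigma> (a @ b) (s @ [j]) u (map ws [0..<l]) < Min (supp (ws l))"
              using ys(2)[of "l + i"] by (simp add: ws_def)
            moreover have "after ((a @ b) @ map ws [0..<l]) (ws l)"
              using ys(2)[of "l + i"] unfolding split by (simp add: ws_def)
            moreover have "ws l \<in> span_seq Y1"
              using ys(2)[of "l + i"] \<sigma>k(1)[of ?m] k[of "ys (l + i)"] by (auto simp: ws_def after_def)
            ultimately show ?thesis by blast
          qed
          ultimately show ?thesis unfolding F_outcomes_def by blast
        qed
        ultimately show False using cs unfolding kills_def by blast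
      qed
      then have "Iw i Y' q'" unfolding as Iw_iff by blast
      then show ?thesis using ext' unfolding as Q_iff by blast
    next
      fix f b assume "W s f b"
      then show "\<exists>n. \<forall>f'\<in>branches q. (\<forall>i<n. f' i = f i) \<longrightarrow> W s f' b" using W_open[of s f b] by blast
    qed
  qed blast
  have c2: "cond Y2 q2" by (rule extends_cond[OF ext2])
  then have pq2: "perfect_tree q2" and YU2: "Y2 \<in> U" by (auto simp: cond_def)
  have "Y2 \<preceq>\<^sup>* X" using extends_trans[OF ext2 ext1] by (simp add: extends_def)
  \<comment> \<open>\<open>Y2\<close> is only almost below \<open>X\<close>, whereas the theorem
    needs \<open>\<preceq>\<close>; hence a member of \<open>U\<close> below both is taken.\<close>
  then obtain Y where Y: "Y \<in> U" "Y \<preceq> X" "Y \<preceq> Y2" using star_refine[OF YU2] by metis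
  have extY2: "extends Y q2 Y2 q2" using Y pq2 by (auto simp: extends_def below_imp_star)
  have extY1: "extends Y q2 Y1 q1" by (rule extends_trans[OF extY2 ext2])
  have b2: "f \<in> branches q1" if "f \<in> branches q2" for f
    using that ext2 branches_mono by (auto simp: extends_def)
  obtain t where t: "t \<in> q2" "length t = N (x, [])"
    by (rule perfect_extend[OF pq2 perfect_Nil[OF pq2], of "N (x, [])"]) auto
  have t1: "t \<in> q1" using t ext2 by (auto simp: extends_def)
  have ext3: "extends Y (subtree q2 t) X p"
    using extends_trans[OF cond_subtree[OF extends_cond[OF extY2] t(1)] extends_trans[OF extY1 ext1]] .
  have "Iw (x, []) Y1 (subtree q1 t) \<or> avoids (Iw (x, [])) Y1 (subtree q1 t)"
    using N[of "(x, [])" t] x t1 t(2) by simp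
  then show thesis
  proof
    assume "Iw (x, []) Y1 (subtree q1 t)"
    then have "Iw (x, []) Y (subtree q2 t)"
      using Iw_hered extends_subtree[OF extY1 t(1)] cond_subtree[OF c1 t1] extends_cond by blast
    moreover have "A [] = range g" by (simp add: A_def)
    ultimately obtain \<sigma> where "branches (subtree q2 t) \<times> F_outcomes x Y \<sigma> \<inter> range g = {}"
      unfolding Iw_iff by auto
    then show thesis using that(1) ext3 Y(2) by blast
  next
    assume live_x: "avoids (Iw (x, [])) Y1 (subtree q1 t)"
    have live_reach: "reach (W s f) Y a" if f: "f \<in> branches q2" and a: "a \<in> ?L" and l: "live a s f" for a s f
    proof -
      have "\<not> Iw (a, s) Y2 (subtree q2 (map f [0..<M (a, s)]))"
        by (rule avoids_branch[OF ext2 f l[unfolded live_def]]) (rule Iw_hered)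
      then have "reach (W s f) Y2 a"
        using M[of "(a, s)" "map f [0..<M (a, s)]"] a branches_node[OF f] branches_subtree_self[OF f]
        unfolding Q_iff by auto
      then show ?thesis using reach_mono below_imp_star[OF Y(3)] U_Einf[OF Y(1)] by blast
    qed
    \<comment> \<open>Even the constant strategy \<open>0\<close> of I fails against
      \<open>A s\<close> on a longer node of \<open>f\<close>, and its failure gives a point of
      \<open>A s\<close> that continues \<open>b\<close> and agrees with \<open>f\<close> up to
      \<open>n\<close>.\<close>
    have live_witness: "\<exists>c h z. (\<forall>i<length s. c i = s ! i) \<and> g c = (h, cat_seq b z) \<and> (\<forall>i<n. h i = f i)"
      if f: "f \<in> branches q2" and l: "live b s f" for b s f n
    proof -
      let ?u = "map f [0..<max (N (b, s)) n]"
      have "extends Y1 (subtree q1 ?u) Y1 (subtree q1 (map f [0..<N (b, s)]))"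
        by (rule extends_branch[OF extends_refl[OF c1] b2[OF f]]) simp
      then have "\<not> Iw (b, s) Y1 (subtree q1 ?u)" using l by (auto simp: live_def avoids_def)
      then have "branches (subtree q1 ?u) \<times> F_outcomes b Y1 (\<lambda>_. 0) \<inter> A s \<noteq> {}"
        unfolding Iw_iff by blast
      then obtain h z' where hz: "h \<in> branches (subtree q1 ?u)" "z' \<in> F_outcomes b Y1 (\<lambda>_. 0)" "(h, z') \<in> A s"
        by blast
      have "map h [0..<length ?u] = ?u" using hz(1) by (simp add: branches_subtree)
      then have "map h [0..<max (N (b, s)) n] = ?u" by simp
      then have "\<forall>i<max (N (b, s)) n. h i = f i" unfolding map_upt_eq_iff .
      then have "\<forall>i<n. h i = f i" by simp
      moreover obtain z where "z' = cat_seq b z" using hz(2) by (auto simp: F_outcomes_def)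
      moreover obtain c where "g c = (h, z')" "\<forall>i<length s. c i = s ! i" using hz(3) by (auto simp: A_def)
      ultimately show ?thesis by blast
    qed
    have "\<exists>\<alpha>. strategy_II_G x Y \<alpha> \<and> G_outcomes x Y \<alpha> \<subseteq> slice_at (range g) f"
      if "f \<in> branches (subtree q2 t)" for f
    proof -
      have f: "f \<in> branches q2" and ft: "map f [0..<length t] = t" using that by (auto simp: branches_subtree)
      \<comment> \<open>In a state, \<open>b\<close> is the position at which \<open>s\<close> was
        last prolonged, or \<open>x\<close> at the start, and \<open>T\<close> is what remains of
        the winning tree towards the next prolongation.\<close>
      define P where "P = (\<lambda>(b, s, T) xs. xs \<in> ?L \<and> prefix b xs \<and> live b s f \<and>
        T \<noteq> Leaf \<and> wins (W s f) Y T xs)"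
      define R where "R = (\<lambda>(b :: 'f vec list, s :: nat list, T :: (nat \<Rightarrow> 'f vec, 'f vec) wtree)
          (y :: 'f vec) (b' :: 'f vec list, s', T').
        (b' = b \<and> s' = s \<and> (T', T) \<in> child_rel) \<or> (length b < length b' \<and> (\<exists>j. s' = s @ [j])))"
      have "live x [] f" using live_x ft t(2) by (simp add: live_def)
      moreover obtain T0 where T0: "T0 \<noteq> Leaf" "wins (W [] f) Y T0 x"
        using reach_wins live_reach[OF f x] calculation by metis
      ultimately have init: "P (x, [], T0) x" using x by (simp add: P_def)
      have step: "\<exists>y\<in>span_seq V. after xs y \<and> (\<exists>st'. R st y st' \<and> P st' (xs @ [y]))"
        if st: "P st xs" and V: "V \<in> Einf" "V \<preceq> Y" for st xs V
      proof -
        obtain b s T where bsT: "st = (b, s, T)" by (cases st)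
        have P: "xs \<in> ?L" "prefix b xs" "live b s f" "T \<noteq> Leaf" "wins (W s f) Y T xs"
          using st by (auto simp: P_def bsT)
        obtain y T' where T: "T = Node y T'" using P(4) by (cases T) auto
        have y: "y V \<in> span_seq V" "after xs (y V)" "wins (W s f) Y (T' V) (xs @ [y V])"
          using P(5) V by (auto simp: T)
        have xsL: "xs @ [y V] \<in> ?L" using P(1) y(2) by (simp add: after_def)
        have "\<exists>st'. R st (y V) st' \<and> P st' (xs @ [y V])"
        proof (cases "T' V = Leaf")
          case True
          then obtain j where j: "live (xs @ [y V]) (s @ [j]) f" using y(3) by (auto simp: W_def)
          obtain T'' where "T'' \<noteq> Leaf" "wins (W (s @ [j]) f) Y T'' (xs @ [y V])"
            using reach_wins live_reach[OF f xsL j] by metis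
          then show ?thesis
            using j xsL prefix_length_le[OF P(2)]
            by (intro exI[of _ "(xs @ [y V], s @ [j], T'')"]) (simp add: R_def P_def bsT)
        next
          case False
          have "(T' V, T) \<in> child_rel" by (auto simp: child_rel_def T)
          then show ?thesis
            using False y(3) P xsL by (intro exI[of _ "(b, s, T' V)"]) (simp add: R_def P_def bsT)
        qed
        then show ?thesis using y by blast
      qed
      obtain \<alpha> where \<alpha>: "strategy_II_G x Y \<alpha>" "\<And>z. z \<in> G_outcomes x Y \<alpha> \<Longrightarrow>
          \<exists>ys S. z = cat_seq x ys \<and> S 0 = (x, [], T0) \<and>
          (\<forall>k. ys k \<in> span_seq Y \<and> P (S k) (x @ map ys [0..<k]) \<and> R (S k) (ys k) (S (Suc k)))"
      proof (rule strategy_from_states[of P "(x, [], T0)" x Y R, OF init])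
        fix st xs V assume "P st xs" "V \<in> Einf" "V \<preceq> Y"
        then show "\<exists>y\<in>span_seq V. after xs y \<and> (\<exists>st'. R st y st' \<and> P st' (xs @ [y]))" by (rule step)
      qed (rule that)
      have "(f, z) \<in> range g" if z: "z \<in> G_outcomes x Y \<alpha>" for z
      proof -
        obtain ys S where zys: "z = cat_seq x ys" and S0: "S 0 = (x, [], T0)" and
          SP: "\<And>k. P (S k) (x @ map ys [0..<k])" and SR: "\<And>k. R (S k) (ys k) (S (Suc k))"
          using \<alpha>(2)[OF z] by blast
        define b s T where "b k = fst (S k)" and "s k = fst (snd (S k))" and "T k = snd (snd (S k))" for k
        have Sk: "S k = (b k, s k, T k)" for k by (simp add: b_def s_def T_def)
        have R: "(b (Suc k) = b k \<and> s (Suc k) = s k \<and> (T (Suc k), T k) \<in> child_rel) \<or>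
            (length (b k) < length (b (Suc k)) \<and> (\<exists>j. s (Suc k) = s k @ [j]))" for k
          using SR[of k] by (simp add: Sk R_def)
        have live_k: "live (b k) (s k) f" and pre_k: "prefix (b k) (x @ map ys [0..<k])" for k
          using SP[of k] by (auto simp: Sk P_def)
        have mono1: "length (b k) \<le> length (b (Suc k)) \<and> prefix (s k) (s (Suc k))" for k
          using R[of k] by auto
        have mono: "length (b k) \<le> length (b l) \<and> prefix (s k) (s l)" if "k \<le> l" for k l
          using that
        proof (induction l rule: dec_induct)
          case (step l)
          then show ?case using mono1[of l] prefix_order.trans by (meson le_trans)
        qed simp
        \<comment> \<open>\<open>child_rel\<close> is well-founded, so a winning tree is exhausted
          after finitely many moves and \<open>s\<close> grows infinitely often.\<close>
        have switch: "\<exists>l\<ge>k. length (b l) < length (b (Suc l)) \<and> (\<exists>j. s (Suc l) = s l @ [j])" for k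
        proof (rule ccontr)
          assume "\<not> ?thesis"
          then have "(T (Suc l), T l) \<in> child_rel" if "l \<ge> k" for l using R[of l] that by blast
          then show False by (auto intro: wf_no_infinite_down_chainE[OF wf_child_rel, of "\<lambda>i. T (k + i)"])
        qed
        have large: "\<exists>k. n \<le> length (b k) \<and> n \<le> length (s k)" for n
        proof (induction n)
          case (Suc n)
          then obtain k where k: "n \<le> length (b k)" "n \<le> length (s k)" by blast
          obtain l j where l: "l \<ge> k" "length (b l) < length (b (Suc l))" "s (Suc l) = s l @ [j]"
            using switch by blast
          have "length (b k) \<le> length (b l)" "length (s k) \<le> length (s l)"
            using mono[OF l(1)] prefix_length_le by auto
          then show ?case using k l by (intro exI[of _ "Suc l"]) simp
        qed simp
        \<comment> \<open>The lists \<open>s k\<close> form a chain under \<open>prefix\<close> with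
          unbounded lengths; \<open>c\<close> is their union and does not depend on the choice of
          \<open>K i\<close>.\<close>
        define K where "K i = (SOME k. i < length (s k))" for i
        have K: "i < length (s (K i))" for i
        proof -
          obtain k where "i < length (s k)" using large[of "Suc i"] by (auto simp: Suc_le_eq)
          then show ?thesis unfolding K_def by (rule someI)
        qed
        define c where "c i = s (K i) ! i" for i
        have c: "c i = s k ! i" if "i < length (s k)" for i k
        proof (cases "k \<le> K i")
          case True
          then obtain r where "s (K i) = s k @ r" using mono by (auto simp: prefix_def)
          then show ?thesis using that by (simp add: c_def nth_append)
        next
          case False
          then obtain r where "s k = s (K i) @ r" using mono[of "K i" k] by (auto simp: prefix_def)
          then show ?thesis using K[of i] by (simp add: c_def nth_append)
        qed
        \<comment> \<open>Coordinate \<open>i\<close> of \<open>g c\<close> depends on finitely many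
          values of \<open>c\<close>. A late \<open>s k\<close> fixes these, and
          \<open>live_witness\<close> gives a \<open>d\<close> extending \<open>s k\<close> for
          which \<open>g d\<close> agrees with \<open>(f, z)\<close> at \<open>i\<close>.\<close>
        have "fst (g c) i = f i \<and> snd (g c) i = z i" for i
        proof -
          obtain m1 where m1: "\<And>d. (\<forall>i<m1. d i = c i) \<Longrightarrow> fst (g d) i = fst (g c) i"
            using cont(1) unfolding seq_cont_def comp_def by metis
          obtain m2 where m2: "\<And>d. (\<forall>i<m2. d i = c i) \<Longrightarrow> snd (g d) i = snd (g c) i"
            using cont(2) unfolding seq_cont_def comp_def by metis
          obtain k where k: "max (Suc i) (max m1 m2) \<le> length (b k)" "max (Suc i) (max m1 m2) \<le> length (s k)"
            using large by blast
          obtain d h w where d: "\<forall>i<length (s k). d i = s k ! i" "g d = (h, cat_seq (b k) w)" "\<forall>j<Suc i. h j = f j"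
            using live_witness[OF f live_k[of k], of "Suc i"] by blast
          have dc: "\<forall>i<length (s k). d i = c i" using d(1) c by simp
          have "fst (g c) i = f i" using m1[of d] dc k d(2,3) by simp
          moreover have "cat_seq (b k) w i = z i"
          proof -
            obtain r where r: "x @ map ys [0..<k] = b k @ r" using pre_k[of k] by (auto simp: prefix_def)
            have i: "i < length (b k)" using k by simp
            have "cat_seq (b k) w i = (x @ map ys [0..<k]) ! i" unfolding r using i by (simp add: cat_seq_def nth_append)
            moreover have "i < length (x @ map ys [0..<k])" unfolding r using i by simp
            ultimately show ?thesis unfolding zys by (auto simp: cat_seq_def nth_append)
          qed
          then have "snd (g c) i = z i" using m2[of d] dc k d(2) by simp
          ultimately show ?thesis by blast
        qed
        then have "g c = (f, z)" by (simp add: prod_eq_iff fun_eq_iff)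
        then show ?thesis by (metis rangeI)
      qed
      then show ?thesis using \<alpha>(1) by (auto simp: slice_at_def)
    qed
    then show thesis using that(2) ext3 Y(2) by blast
  qed
qed

end

theorem theorem7p6:
  fixes U :: "(nat \<Rightarrow> 'f::{field,countable} vec) set"
    and A :: "((nat \<Rightarrow> bool) \<times> (nat \<Rightarrow> 'f vec)) set"
  assumes "strategic U" and "p_plus_filter U"
    and "A \<subseteq> UNIV \<times> Einf" and "analytic A"
  shows "perfectly_strat_Ramsey U A"
proof -
  interpret strategic_filter U by unfold_locales fact+
  show ?thesis
    unfolding perfectly_strat_Ramsey_def
  proof (intro ballI allI impI)
    fix x :: "'f vec list" and X p
    assume x: "x \<in> Efin" and X: "X \<in> U" and p: "perfect_tree p"
    have c0: "cond X p" using X p by (simp add: cond_def)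
    have xL: "x \<in> lists {v. nzE v}" using x by (auto simp: Efin_def)
    show "\<exists>Y\<in>U \<restriction> X. \<exists>q. perfect_tree q \<and> q \<subseteq> p \<and>
       ((\<exists>\<sigma>. branches q \<times> F_outcomes x Y \<sigma> \<inter> A = {}) \<or>
        (\<forall>f\<in>branches q. \<exists>\<alpha>. strategy_II_G x Y \<alpha> \<and> G_outcomes x Y \<alpha> \<subseteq> slice_at A f))"
    \<comment> \<open>\<open>analytic\<close> admits the empty set, which has no parametrization
      \<open>g\<close>; any strategy of I avoids it.\<close>
    proof (cases "A = {}")
      case True
      then show ?thesis using X p by (auto simp: restr_def below_def intro!: bexI[of _ X] exI[of _ p])
    next
      case False
      then obtain g :: "(nat \<Rightarrow> nat) \<Rightarrow> (nat \<Rightarrow> bool) \<times> (nat \<Rightarrow> 'f vec)"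
        where g: "seq_cont (fst \<circ> g)" "seq_cont (snd \<circ> g)" "A = range g"
        using assms(4) by (auto simp: analytic_def)
      show ?thesis
        by (rule analytic_dichotomy[OF g(1,2) xL c0, folded g(3)])
          (unfold extends_def restr_def, blast+)
    qed
  qed
qed

end
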